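(* Let $(M,K)$ be a Cartan space of dimension $n\ge 3$, let $v:[0,\infty)\to\mathbb{R}$ be smooth and let $\alpha,\beta$ be real constants with $\alpha,\beta>0$ and $\alpha+2\tau v(\tau)>0$ on $T^{*}M_0$, where $\tau=\frac12K^2$. Let $G_{ij}=\frac1\beta g_{ij}+\frac{v(\tau)}{\alpha\beta}p_ip_j$, $(G^{ij})=(G_{ij})^{-1}$, and let $J$ be the almost complex structure on $T^{*}M_0$ given by $J(\delta_i)=G_{ik}\dot\partial^k$, $J(\dot\partial^i)=-G^{ik}\delta_k$. Then $J$ is integrable if and only if there is a real constant $c$ such that $$R_{kij}=c\,(g_{jk}p_i-g_{ik}p_j)$$ (in all induced local coordinates, for all $i,j,k$) and the function $v$ is given by $v=-c\alpha\beta^2$. Here $R_{kij}$ is defined by $[\delta_i,\delta_j]=R_{kij}\dot\partial^k$.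
   Context: $M$ is a smooth $n$-dimensional manifold, $T^{*}M_0$ is its cotangent bundle with the zero section removed, $(x^i,p_i)$ are the induced local coordinates, $\partial_i=\partial/\partial x^i$, $\dot\partial^i=\partial/\partial p_i$; the summation convention is used. A Cartan space $(M,K)$ is a manifold $M$ with a function $K:T^{*}M\to[0,\infty)$ that is $C^\infty$ on $T^{*}M_0$, satisfies $K(x,\lambda p)=\lambda K(x,p)$ for $\lambda>0$, and for which $g^{ij}(x,p)=\frac12\dot\partial^i\dot\partial^jK^2$ is positive definite on $T^{*}M_0$. Let $(g_{ij})=(g^{ij})^{-1}$ and $p^i=g^{ij}p_j=\frac12\dot\partial^iK^2$, so $K^2=g^{ij}p_ip_j$. Nonlinear connection: with $\gamma^i_{jk}=\frac12g^{is}(\partial_kg_{js}+\partial_jg_{sk}-\partial_sg_{jk})$, $\gamma^\circ_{jk}=\gamma^i_{jk}p_i$ and $\gamma^\circ_{j\circ}=\gamma^i_{jk}p_ip^k$, put $N_{ij}=\gamma^\circ_{ij}-\frac12\gamma^\circ_{h\circ}\dot\partial^hg_{ij}$ (symmetric in $i,j$). Then $\delta_i=\partial_i+N_{ij}\dot\partial^j$ and $\dot\partial^i$ form a local frame of $T(T^{*}M_0)$. The relation $[\delta_i,\delta_j]=R_{kij}\dot\partial^k$ means $R_{kij}=\delta_iN_{jk}-\delta_jN_{ik}$. Integrability of $J$ means vanishing of the Nijenhuis tensor $N_J(X,Y)=[JX,JY]-J[JX,Y]-J[X,JY]-[X,Y]$. *)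

theory Defs
  imports "HOL-Analysis.Analysis"
begin

section \<open>Smooth functions\<close>

text \<open>\<open>Ck_on k S f\<close> is meant for open \<open>S\<close>; there it says that \<open>f\<close> is of class $C^k$ on \<open>S\<close>.\<close>

primrec Ck_on :: "nat \<Rightarrow> 'a::euclidean_space set \<Rightarrow> ('a \<Rightarrow> 'b::real_normed_vector) \<Rightarrow> bool" where
  "Ck_on 0 S f \<longleftrightarrow> continuous_on S f"
| "Ck_on (Suc k) S f \<longleftrightarrow> (\<forall>x\<in>S. f differentiable (at x)) \<and>
     (\<forall>h. Ck_on k S (\<lambda>x. frechet_derivative f (at x) h))"

definition smooth_on :: "'a::euclidean_space set \<Rightarrow> ('a \<Rightarrow> 'b::real_normed_vector) \<Rightarrow> bool" where
  "smooth_on S f \<longleftrightarrow> (\<forall>k. Ck_on k S f)"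

text \<open>Smoothness on the closed half-line: all derivatives exist, one-sided ones at \<open>0\<close>;
  \<open>d k\<close> is the \<open>k\<close>-th derivative.\<close>

definition smooth_on_halfline :: "(real \<Rightarrow> real) \<Rightarrow> bool" where
  "smooth_on_halfline f \<longleftrightarrow> (\<exists>d :: nat \<Rightarrow> real \<Rightarrow> real. (\<forall>t\<ge>0. d 0 t = f t) \<and>
     (\<forall>k. \<forall>t\<ge>0. (d k has_real_derivative d (Suc k) t) (at t within {0..})))"


section \<open>Smooth manifolds\<close>

text \<open>A chart is a pair of its domain and its coordinate map; the values of the coordinate map
  outside the domain are irrelevant.\<close>

type_synonym ('m, 'n) chart = "'m set \<times> ('m \<Rightarrow> real ^ 'n)"

definition chart_image :: "('m, 'n::finite) chart \<Rightarrow> (real ^ 'n) set" where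
  "chart_image c = snd c ` fst c"

definition is_chart :: "'m topology \<Rightarrow> ('m, 'n::finite) chart \<Rightarrow> bool" where
  "is_chart M c \<longleftrightarrow> openin M (fst c) \<and> open (chart_image c) \<and>
     homeomorphic_map (subtopology M (fst c)) (top_of_set (chart_image c)) (snd c)"

definition transition :: "('m, 'n::finite) chart \<Rightarrow> ('m, 'n) chart \<Rightarrow> real ^ 'n \<Rightarrow> real ^ 'n" where
  "transition c d = snd d \<circ> inv_into (fst c) (snd c)"

definition smooth_compatible :: "('m, 'n::finite) chart \<Rightarrow> ('m, 'n) chart \<Rightarrow> bool" where
  "smooth_compatible c d \<longleftrightarrow>
     smooth_on (snd c ` (fst c \<inter> fst d)) (transition c d) \<and>
     smooth_on (snd d ` (fst c \<inter> fst d)) (transition d c)"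

text \<open>\<open>A\<close> is a smooth structure, i.e. a maximal smooth atlas, on the (nonempty) space \<open>M\<close>.\<close>

definition smooth_manifold :: "'m topology \<Rightarrow> ('m, 'n::finite) chart set \<Rightarrow> bool" where
  "smooth_manifold M A \<longleftrightarrow>
     topspace M \<noteq> {} \<and> Hausdorff_space M \<and> second_countable M \<and>
     (\<forall>c\<in>A. is_chart M c) \<and> (\<Union>c\<in>A. fst c) = topspace M \<and>
     (\<forall>c\<in>A. \<forall>d\<in>A. smooth_compatible c d) \<and>
     (\<forall>c. is_chart M c \<and> (\<forall>d\<in>A. smooth_compatible c d) \<longrightarrow> c \<in> A)"


section \<open>The cotangent bundle\<close>

text \<open>A covector at \<open>q\<close> is the family of its components in the charts around \<open>q\<close> (extended by
  \<open>0\<close> to the other charts), subject to the transformation law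
  $p_i = \frac{\partial \tilde x^j}{\partial x^i}\, \tilde p_j$.\<close>

type_synonym ('m, 'n) covector = "('m, 'n) chart \<Rightarrow> real ^ 'n"

definition cotangent_space ::
    "('m, 'n::finite) chart set \<Rightarrow> 'm \<Rightarrow> ('m, 'n) covector set" where
  "cotangent_space A q = {\<omega>.
     (\<forall>c. \<not> (c \<in> A \<and> q \<in> fst c) \<longrightarrow> \<omega> c = 0) \<and>
     (\<forall>c\<in>A. \<forall>d\<in>A. q \<in> fst c \<and> q \<in> fst d \<longrightarrow>
        \<omega> c = \<omega> d v* jacobian (transition c d) (at (snd c q)))}"

definition cotangent_bundle ::
    "'m topology \<Rightarrow> ('m, 'n::finite) chart set \<Rightarrow> ('m \<times> ('m, 'n) covector) set" where
  "cotangent_bundle M A = Sigma (topspace M) (cotangent_space A)"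

definition slit_cotangent_bundle ::
    "'m topology \<Rightarrow> ('m, 'n::finite) chart set \<Rightarrow> ('m \<times> ('m, 'n) covector) set" where
  "slit_cotangent_bundle M A = {(q, \<omega>) \<in> cotangent_bundle M A. \<omega> \<noteq> (\<lambda>_. 0)}"

text \<open>Values $(x,p)$ of induced coordinates, and also components of tangent vectors of the
  cotangent bundle with respect to the coordinate frame $(\partial_i, \dot\partial^i)$.\<close>

type_synonym 'n coords = "(real ^ 'n) \<times> (real ^ 'n)"

definition induced_coords ::
    "('m, 'n::finite) chart \<Rightarrow> 'm \<times> ('m, 'n) covector \<Rightarrow> 'n coords" where
  "induced_coords c = (\<lambda>(q, \<omega>). (snd c q, \<omega> c))"

definition slit_domain :: "('m, 'n::finite) chart \<Rightarrow> 'n coords set" where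
  "slit_domain c = chart_image c \<times> (- {0})"

definition local_rep ::
    "'m topology \<Rightarrow> ('m, 'n::finite) chart set \<Rightarrow> ('m \<times> ('m, 'n) covector \<Rightarrow> real) \<Rightarrow>
     ('m, 'n) chart \<Rightarrow> 'n coords \<Rightarrow> real" where
  "local_rep M A K c =
     K \<circ> inv_into {u \<in> cotangent_bundle M A. fst u \<in> fst c} (induced_coords c)"


section \<open>Local calculus in induced coordinates\<close>

text \<open>In this section \<open>L\<close> is the local representative of \<open>K\<close> and \<open>z = (x, p)\<close>.
  \<open>bpartial\<close> is $\partial_i$ and \<open>fpartial\<close> is $\dot\partial^i$ on functions.\<close>

definition bpartial :: "'n::finite \<Rightarrow> ('n coords \<Rightarrow> real) \<Rightarrow> 'n coords \<Rightarrow> real" where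
  "bpartial i f z = frechet_derivative f (at z) (axis i 1, 0)"

definition fpartial :: "'n::finite \<Rightarrow> ('n coords \<Rightarrow> real) \<Rightarrow> 'n coords \<Rightarrow> real" where
  "fpartial i f z = frechet_derivative f (at z) (0, axis i 1)"

definition gup :: "('n::finite coords \<Rightarrow> real) \<Rightarrow> 'n coords \<Rightarrow> real ^ 'n ^ 'n" where
  "gup L z = (\<chi> i j. 1/2 * fpartial i (fpartial j (\<lambda>w. (L w)\<^sup>2)) z)"

definition glow :: "('n::finite coords \<Rightarrow> real) \<Rightarrow> 'n coords \<Rightarrow> real ^ 'n ^ 'n" where
  "glow L z = matrix_inv (gup L z)"

definition pup :: "('n::finite coords \<Rightarrow> real) \<Rightarrow> 'n coords \<Rightarrow> 'n \<Rightarrow> real" where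
  "pup L z i = (\<Sum>j\<in>UNIV. gup L z $ i $ j * snd z $ j)"

definition christoffel ::
    "('n::finite coords \<Rightarrow> real) \<Rightarrow> 'n \<Rightarrow> 'n \<Rightarrow> 'n \<Rightarrow> 'n coords \<Rightarrow> real" where
  "christoffel L i j k z = 1/2 * (\<Sum>s\<in>UNIV. gup L z $ i $ s *
     (bpartial k (\<lambda>w. glow L w $ j $ s) z + bpartial j (\<lambda>w. glow L w $ s $ k) z
        - bpartial s (\<lambda>w. glow L w $ j $ k) z))"

text \<open>\<open>christoffel_o\<close> and \<open>christoffel_oo\<close> are $\gamma^\circ_{jk}$ and
  $\gamma^\circ_{j\circ}$.\<close>

definition christoffel_o ::
    "('n::finite coords \<Rightarrow> real) \<Rightarrow> 'n \<Rightarrow> 'n \<Rightarrow> 'n coords \<Rightarrow> real" where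
  "christoffel_o L j k z = (\<Sum>i\<in>UNIV. christoffel L i j k z * snd z $ i)"

definition christoffel_oo ::
    "('n::finite coords \<Rightarrow> real) \<Rightarrow> 'n \<Rightarrow> 'n coords \<Rightarrow> real" where
  "christoffel_oo L j z = (\<Sum>k\<in>UNIV. christoffel_o L j k z * pup L z k)"

definition nonlin_conn ::
    "('n::finite coords \<Rightarrow> real) \<Rightarrow> 'n \<Rightarrow> 'n \<Rightarrow> 'n coords \<Rightarrow> real" where
  "nonlin_conn L i j z = christoffel_o L i j z
     - 1/2 * (\<Sum>h\<in>UNIV. christoffel_oo L h z * fpartial h (\<lambda>w. glow L w $ i $ j) z)"

text \<open>The adapted frame $\delta_i = \partial_i + N_{ij}\dot\partial^j$, $\dot\partial^i$.\<close>

definition hframe :: "('n::finite coords \<Rightarrow> real) \<Rightarrow> 'n \<Rightarrow> 'n coords \<Rightarrow> 'n coords" where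
  "hframe L i z = (axis i 1, \<chi> j. nonlin_conn L i j z)"

definition vframe :: "'n::finite \<Rightarrow> 'n coords" where
  "vframe i = (0, axis i 1)"

definition lie_bracket ::
    "('a::real_normed_vector \<Rightarrow> 'a) \<Rightarrow> ('a \<Rightarrow> 'a) \<Rightarrow> 'a \<Rightarrow> 'a" where
  "lie_bracket X Y z =
     frechet_derivative Y (at z) (X z) - frechet_derivative X (at z) (Y z)"

text \<open>$R_{kij} = \delta_i N_{jk} - \delta_j N_{ik}$; see \<open>lie_bracket_hframe\<close> below.\<close>

definition curv ::
    "('n::finite coords \<Rightarrow> real) \<Rightarrow> 'n \<Rightarrow> 'n \<Rightarrow> 'n \<Rightarrow> 'n coords \<Rightarrow> real" where
  "curv L k i j z =
     frechet_derivative (nonlin_conn L j k) (at z) (hframe L i z)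
     - frechet_derivative (nonlin_conn L i k) (at z) (hframe L j z)"

definition tau :: "real \<Rightarrow> real" where
  "tau r = 1/2 * r\<^sup>2"

definition Glow ::
    "(real \<Rightarrow> real) \<Rightarrow> real \<Rightarrow> real \<Rightarrow> ('n::finite coords \<Rightarrow> real) \<Rightarrow> 'n coords \<Rightarrow> real ^ 'n ^ 'n" where
  "Glow v \<alpha> \<beta> L z = (\<chi> i j. 1 / \<beta> * glow L z $ i $ j
     + v (tau (L z)) / (\<alpha> * \<beta>) * snd z $ i * snd z $ j)"

definition Gup ::
    "(real \<Rightarrow> real) \<Rightarrow> real \<Rightarrow> real \<Rightarrow> ('n::finite coords \<Rightarrow> real) \<Rightarrow> 'n coords \<Rightarrow> real ^ 'n ^ 'n" where
  "Gup v \<alpha> \<beta> L z = matrix_inv (Glow v \<alpha> \<beta> L z)"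


section \<open>Cartan spaces and integrability\<close>

definition cartan_space ::
    "'m topology \<Rightarrow> ('m, 'n::finite) chart set \<Rightarrow> ('m \<times> ('m, 'n) covector \<Rightarrow> real) \<Rightarrow> bool" where
  "cartan_space M A K \<longleftrightarrow> smooth_manifold M A \<and>
     (\<forall>u\<in>cotangent_bundle M A. 0 \<le> K u) \<and>
     (\<forall>c\<in>A. smooth_on (slit_domain c) (local_rep M A K c)) \<and>
     (\<forall>(q, \<omega>)\<in>cotangent_bundle M A. \<forall>r>0. K (q, \<lambda>d. r *\<^sub>R \<omega> d) = r * K (q, \<omega>)) \<and>
     (\<forall>c\<in>A. \<forall>z\<in>slit_domain c. \<forall>\<xi>. \<xi> \<noteq> 0 \<longrightarrow> 0 < \<xi> \<bullet> (gup (local_rep M A K c) z *v \<xi>))"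

definition nijenhuis ::
    "('a::real_normed_vector \<Rightarrow> 'a \<Rightarrow> 'a) \<Rightarrow> ('a \<Rightarrow> 'a) \<Rightarrow> ('a \<Rightarrow> 'a) \<Rightarrow> 'a \<Rightarrow> 'a" where
  "nijenhuis J X Y z =
     lie_bracket (\<lambda>w. J w (X w)) (\<lambda>w. J w (Y w)) z
     - J z (lie_bracket (\<lambda>w. J w (X w)) Y z)
     - J z (lie_bracket X (\<lambda>w. J w (Y w)) z)
     - lie_bracket X Y z"

text \<open>\<open>J c z\<close> is the matrix, as a linear map on components, of an endomorphism field on the slit
  cotangent bundle in the chart induced by \<open>c\<close>.  The Nijenhuis tensor is local, so it vanishes
  iff it vanishes in each chart on all smooth vector fields on the chart domain.\<close>

definition integrable_acs ::
    "('m, 'n::finite) chart set \<Rightarrow>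
     (('m, 'n) chart \<Rightarrow> 'n coords \<Rightarrow> 'n coords \<Rightarrow> 'n coords) \<Rightarrow> bool" where
  "integrable_acs A J \<longleftrightarrow> (\<forall>c\<in>A. \<forall>X Y.
     smooth_on (slit_domain c) X \<longrightarrow> smooth_on (slit_domain c) Y \<longrightarrow>
     (\<forall>z\<in>slit_domain c. nijenhuis (J c) X Y z = 0))"


section \<open>Consistency of the encoding\<close>

text \<open>Induced coordinates are global coordinates on the bundle over the chart domain, so that
  \<open>local_rep\<close> is the coordinate expression of \<open>K\<close>.\<close>

lemma bij_betw_induced_coords:
  assumes M: "smooth_manifold M A" and c: "c \<in> A"
  shows "bij_betw (induced_coords c) {u \<in> cotangent_bundle M A. fst u \<in> fst c}
           (chart_image c \<times> UNIV)"
proof -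
  have ch: "is_chart M d" if "d \<in> A" for d
    using M that by (auto simp: smooth_manifold_def)
  have sub: "fst d \<subseteq> topspace M" if "d \<in> A" for d
    using ch[OF that] by (auto simp: is_chart_def openin_subset)
  have inj: "inj_on (snd d) (fst d)" if "d \<in> A" for d
    using ch[OF that] sub[OF that]
    by (auto simp: is_chart_def homeomorphic_map_def topspace_subtopology Int_absorb1)
  have inv: "inv_into (fst d) (snd d) (snd d q) = q" if "d \<in> A" "q \<in> fst d" for d q
    using inj that by simp
  have opn: "open (snd d ` (fst d \<inter> fst e))" if "d \<in> A" "e \<in> A" for d e
  proof -
    have "openin (subtopology M (fst d)) (fst d \<inter> fst e)"
      using ch[OF that(2)] by (auto simp: is_chart_def openin_subtopology)
    then have "openin (top_of_set (chart_image d)) (snd d ` (fst d \<inter> fst e))"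
      using ch[OF that(1)] homeomorphic_map_openness_eq unfolding is_chart_def by blast
    then show ?thesis
      using ch[OF that(1)] openin_open_trans unfolding is_chart_def by blast
  qed
  have diff: "transition d e differentiable (at (snd d q))"
    if "d \<in> A" "e \<in> A" "q \<in> fst d" "q \<in> fst e" for d e q
  proof -
    have "Ck_on (Suc 0) (snd d ` (fst d \<inter> fst e)) (transition d e)"
      using M that unfolding smooth_manifold_def smooth_compatible_def smooth_on_def by blast
    then show ?thesis using that by auto
  qed
  have tr: "transition d e (snd d q) = snd e q" if "d \<in> A" "q \<in> fst d" for d e q
    using that inv by (simp add: transition_def)
  have chain: "jacobian (transition d b) (at (snd d q)) =
      jacobian (transition e b) (at (snd e q)) ** jacobian (transition d e) (at (snd d q))"
    if "d \<in> A" "e \<in> A" "b \<in> A" "q \<in> fst d" "q \<in> fst e" "q \<in> fst b" for d e b q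
  proof -
    have "(transition e b \<circ> transition d e has_derivative
        ((*v) (jacobian (transition e b) (at (snd e q))) \<circ>
         (*v) (jacobian (transition d e) (at (snd d q))))) (at (snd d q))"
      using diff that by (intro diff_chain_at) (auto simp: tr jacobian_works[symmetric])
    then have "(transition d b has_derivative
        ((*v) (jacobian (transition e b) (at (snd e q))) \<circ>
         (*v) (jacobian (transition d e) (at (snd d q))))) (at (snd d q))"
    proof (rule has_derivative_transform_within_open)
      show "open (snd d ` (fst d \<inter> fst e))" "snd d q \<in> snd d ` (fst d \<inter> fst e)"
        using opn that by auto
      show "(transition e b \<circ> transition d e) x = transition d b x"
        if "x \<in> snd d ` (fst d \<inter> fst e)" for x
        using that \<open>d \<in> A\<close> \<open>e \<in> A\<close> by (auto simp: tr)
    qed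
    from frechet_derivative_at[OF this]
    have "jacobian (transition d b) (at (snd d q)) =
        matrix ((*v) (jacobian (transition e b) (at (snd e q))) \<circ>
         (*v) (jacobian (transition d e) (at (snd d q))))"
      unfolding jacobian_def by simp
    then show ?thesis
      by (simp only: matrix_compose matrix_vector_mul_linear matrix_of_matrix_vector_mul)
  qed
  have selfj: "jacobian (transition c c) (at (snd c q)) = mat 1" if "q \<in> fst c" for q
  proof -
    have "(transition c c has_derivative id) (at (snd c q))"
    proof (rule has_derivative_transform_within_open[OF has_derivative_id])
      show "open (snd c ` (fst c \<inter> fst c))" "snd c q \<in> snd c ` (fst c \<inter> fst c)"
        using opn[OF c c] that by auto
    qed (use c in \<open>auto simp: tr\<close>)
    from frechet_derivative_at[OF this] show ?thesis
      by (metis jacobian_def matrix_id_mat_1)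
  qed
  show ?thesis
  proof (rule bij_betw_imageI)
    show "inj_on (induced_coords c) {u \<in> cotangent_bundle M A. fst u \<in> fst c}"
    proof (rule inj_onI, clarsimp simp: induced_coords_def)
      fix q \<omega> q' \<omega>'
      assume u: "(q, \<omega>) \<in> cotangent_bundle M A" "(q', \<omega>') \<in> cotangent_bundle M A"
        and q: "q \<in> fst c" "q' \<in> fst c" "snd c q = snd c q'" and eq: "\<omega> c = \<omega>' c"
      have "q = q'" using inj[OF c] q by (auto dest: inj_onD)
      moreover have "\<omega> d = \<omega>' d" for d
      proof (cases "d \<in> A \<and> q \<in> fst d")
        case True
        let ?j = "jacobian (transition d c) (at (snd d q))"
        have "\<omega> d = \<omega> c v* ?j" "\<omega>' d = \<omega>' c v* ?j"
          using u c q(1) True \<open>q = q'\<close>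
          unfolding cotangent_bundle_def cotangent_space_def by blast+
        then show ?thesis by (simp only: eq)
      next
        case False
        then have "\<omega> d = 0" "\<omega>' d = 0"
          using u \<open>q = q'\<close> unfolding cotangent_bundle_def cotangent_space_def by blast+
        then show ?thesis by (simp only:)
      qed
      ultimately show "q = q' \<and> \<omega> = \<omega>'" by auto
    qed
    show "induced_coords c ` {u \<in> cotangent_bundle M A. fst u \<in> fst c} = chart_image c \<times> UNIV"
    proof (intro equalityI subsetI)
      fix z assume "z \<in> chart_image c \<times> (UNIV :: (real ^ 'b) set)"
      then obtain q p where z: "z = (snd c q, p)" and q: "q \<in> fst c"
        by (auto simp: chart_image_def)
      define \<omega> where "\<omega> = (\<lambda>d. if d \<in> A \<and> q \<in> fst d
        then p v* jacobian (transition d c) (at (snd d q)) else 0)"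
      have "\<omega> \<in> cotangent_space A q"
        unfolding cotangent_space_def
      proof (intro CollectI conjI allI ballI impI)
        fix d e assume de: "d \<in> A" "e \<in> A" "q \<in> fst d \<and> q \<in> fst e"
        then show "\<omega> d = \<omega> e v* jacobian (transition d e) (at (snd d q))"
          by (simp add: \<omega>_def vector_matrix_mul_assoc chain[of d e c, symmetric] c q)
      qed (auto simp: \<omega>_def)
      moreover have "\<omega> c = p"
        using c q selfj by (simp add: \<omega>_def)
      ultimately show "z \<in> induced_coords c ` {u \<in> cotangent_bundle M A. fst u \<in> fst c}"
        using z q sub[OF c]
        by (intro image_eqI[of _ _ "(q, \<omega>)"]) (auto simp: induced_coords_def cotangent_bundle_def)
    qed (auto simp: induced_coords_def chart_image_def)
  qed
qed

text \<open>$[\delta_i, \delta_j] = R_{kij}\dot\partial^k$.\<close>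

lemma lie_bracket_hframe:
  assumes "\<And>i j. nonlin_conn L i j differentiable (at z)"
  shows "lie_bracket (hframe L i) (hframe L j) z = (\<Sum>k\<in>UNIV. curv L k i j z *\<^sub>R vframe k)"
proof -
  have D: "frechet_derivative (hframe L i) (at z) =
      (\<lambda>h. (0, \<chi> k. frechet_derivative (nonlin_conn L i k) (at z) h))" for i
  proof (rule frechet_derivative_at[symmetric])
    show "(hframe L i has_derivative
        (\<lambda>h. (0, \<chi> k. frechet_derivative (nonlin_conn L i k) (at z) h))) (at z)"
      unfolding hframe_def
    proof (intro has_derivative_Pair has_derivative_const)
      show "((\<lambda>z. \<chi> j. nonlin_conn L i j z) has_derivative
          (\<lambda>h. \<chi> k. frechet_derivative (nonlin_conn L i k) (at z) h)) (at z)"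
        using assms
        by (subst has_derivative_componentwise_within)
           (auto simp: Basis_vec_def inner_axis frechet_derivative_works[symmetric])
    qed
  qed
  show ?thesis
    by (simp add: lie_bracket_def D vframe_def curv_def prod_eq_iff vec_eq_iff fst_sum snd_sum
          axis_def if_distrib[of "\<lambda>x. _ * x"] sum.delta cong: if_cong)
qed

end

theory Submission
  imports Defs
begin

text \<open>The Nijenhuis tensor is determined by its values on the horizontal frame \<open>\<delta>\<^sub>i\<close>, because the
  fields \<open>\<delta>\<^sub>i\<close> and \<open>J \<delta>\<^sub>i\<close> span and \<open>N_J(J X, Y) = - J N_J(X, Y)\<close>.  On the frame, the horizontal
  part of \<open>N_J(\<delta>\<^sub>i, \<delta>\<^sub>j)\<close> vanishes identically: the connection is torsion free (a Jacobi identity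
  for the geodesic spray), symmetric, homogeneous, and it annihilates \<open>K\<close>.  The vertical part is
  $\frac{v}{\alpha\beta^2}(g_{ik} p_j - g_{jk} p_i) - R_{kij}$.  Hence \<open>J\<close> is integrable iff
  $R_{kij} = -\frac{v(\tau)}{\alpha\beta^2}(g_{jk} p_i - g_{ik} p_j)$, and since both \<open>R\<close> and
  $g_{jk} p_i - g_{ik} p_j$ are homogeneous of degree one in \<open>p\<close>, this forces \<open>v\<close> to be constant
  along a ray of momenta, i.e. on the whole half-line.\<close>

text \<open>The obstacle is the torsion identity: with the Christoffel formula for \<open>N\<close>
  written out, it relates derivatives of the metric and its inverse in long index sums. The way
  round is to let the energy H = K^2/2 carry everything: p^i is its momentum gradient, g^{ij} its
  momentum Hessian, and with the Hamiltonian field \<xi> of H the connection collapses to N_jk =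
  -1/2 (g_js \<partial>_k p^s + g_ks \<partial>_j p^s + \<xi> g_jk). This exhibits \<delta>_i
  through [\<xi>, E_i] and D_i, where D_i and E_i are the coordinate fields of the dual coordinates
  (x^i, p^i). Acting on functions, all these fields become operators, and the identity compares
  words in \<xi>, D_i, E_i applied to the single function p_l. The constant v/(\<alpha>\<beta>^2)
  has two sources: differentiating p_j p_l in G_jl along J \<delta>_i = G_ik \<partial>^k yields
  v/(\<alpha>\<beta>) (p_j G_il - p_i G_jl) after antisymmetrization, and of G_il only g_il/\<beta>
  survives, since its p_i p_l part cancels.\<close>

abbreviation dd :: "'a::real_normed_vector \<Rightarrow> ('a \<Rightarrow> 'b::real_normed_vector) \<Rightarrow> 'a \<Rightarrow> 'b" where
  "dd h f z \<equiv> frechet_derivative f (at z) h"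

section \<open>Calculus of smooth functions\<close>

lemma dd_eqI: "(f has_derivative f') (at z) \<Longrightarrow> dd h f z = f' h"
  by (metis frechet_derivative_at)

lemma has_derivative_dd:
  "f differentiable (at z) \<Longrightarrow> (f has_derivative (\<lambda>h. dd h f z)) (at z)"
  by (simp add: frechet_derivative_works)

text \<open>Locally equal functions have the same derivatives, and \<open>frechet_derivative\<close>
  picks one by \<open>SOME\<close>; equal candidates give equal picks. This is what lets an identity
  known only on an open set be differentiated.\<close>

lemma dd_cong:
  assumes "open S" "z \<in> S" "\<And>w. w \<in> S \<Longrightarrow> f w = g w"
  shows "dd h f z = dd h g z"
proof -
  have "(f has_derivative f') (at z) \<longleftrightarrow> (g has_derivative f') (at z)" for f'
    using assms by (metis has_derivative_transform_within_open)
  then show ?thesis by (simp add: frechet_derivative_def)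
qed

lemma differentiable_cong_open:
  assumes "open S" "z \<in> S" "\<And>w. w \<in> S \<Longrightarrow> f w = g w"
  shows "f differentiable (at z) \<longleftrightarrow> g differentiable (at z)"
  using assms unfolding differentiable_def by (metis has_derivative_transform_within_open)

lemma dd_add:
  assumes "f differentiable (at z)" "g differentiable (at z)"
  shows "dd h (\<lambda>w. f w + g w) z = dd h f z + dd h g z"
  by (rule dd_eqI) (intro has_derivative_add has_derivative_dd assms)

lemma dd_diff:
  assumes "f differentiable (at z)" "g differentiable (at z)"
  shows "dd h (\<lambda>w. f w - g w) z = dd h f z - dd h g z"
  by (rule dd_eqI) (intro has_derivative_diff has_derivative_dd assms)

lemma dd_minus:
  assumes "f differentiable (at z)"
  shows "dd h (\<lambda>w. - f w) z = - dd h f z"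
  by (rule dd_eqI) (intro has_derivative_minus has_derivative_dd assms)

lemma dd_sum:
  assumes "\<And>i. i \<in> I \<Longrightarrow> f i differentiable (at z)"
  shows "dd h (\<lambda>w. \<Sum>i\<in>I. f i w) z = (\<Sum>i\<in>I. dd h (f i) z)"
  by (rule dd_eqI) (intro has_derivative_sum has_derivative_dd assms)

lemma dd_mult:
  fixes f g :: "'a::real_normed_vector \<Rightarrow> real"
  assumes "f differentiable (at z)" "g differentiable (at z)"
  shows "dd h (\<lambda>w. f w * g w) z = f z * dd h g z + dd h f z * g z"
  by (rule dd_eqI) (intro has_derivative_mult has_derivative_dd assms)

lemma dd_cmult:
  fixes f :: "'a::real_normed_vector \<Rightarrow> real"
  assumes "f differentiable (at z)"
  shows "dd h (\<lambda>w. c * f w) z = c * dd h f z"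
  by (rule dd_eqI) (intro has_derivative_mult_right has_derivative_dd assms)

lemma dd_bounded_linear: "bounded_linear f \<Longrightarrow> dd h f z = f h"
  by (rule dd_eqI) (rule bounded_linear.has_derivative[OF _ has_derivative_ident])

lemma linear_dd: "f differentiable (at z) \<Longrightarrow> linear (\<lambda>h. dd h f z)"
  by (rule linear_frechet_derivative)

section \<open>Functions of class C^k and smooth functions\<close>

lemma Ck_on_cong:
  assumes "open S" "\<And>w. w \<in> S \<Longrightarrow> f w = g w"
  shows "Ck_on k S f \<longleftrightarrow> Ck_on k S g"
  using assms(2)
proof (induction k arbitrary: f g)
  case 0
  then show ?case by (auto intro: continuous_on_cong)
next
  case (Suc k)
  have "Ck_on k S (dd h f) \<longleftrightarrow> Ck_on k S (dd h g)" for h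
    by (rule Suc.IH) (rule dd_cong[OF assms(1) _ Suc.prems])
  then show ?case
    using differentiable_cong_open[OF assms(1) _ Suc.prems] by auto
qed

lemma Ck_on_SucD: "Ck_on (Suc k) S f \<Longrightarrow> Ck_on k S f"
proof (induction k arbitrary: f)
  case 0
  then show ?case
    unfolding Ck_on.simps
    by (intro differentiable_imp_continuous_on differentiable_at_imp_differentiable_on) auto
next
  case (Suc k)
  have "Ck_on k S (dd h f)" for h
    using Suc.prems unfolding Ck_on.simps(2)[of "Suc k"] by (intro Suc.IH) blast
  then show ?case
    using Suc.prems unfolding Ck_on.simps(2)[of "Suc k"] Ck_on.simps(2)[of k S f] by blast
qed

lemma Ck_on_const: "Ck_on k S (\<lambda>_. c)"
  by (induction k arbitrary: c) auto

lemma Ck_on_bounded_linear: "bounded_linear f \<Longrightarrow> Ck_on k S f"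
proof (cases k)
  case 0
  then show "bounded_linear f \<Longrightarrow> ?thesis" by (simp add: linear_continuous_on)
next
  case (Suc m)
  assume f: "bounded_linear f"
  then show ?thesis
    using Suc by (auto simp: dd_bounded_linear Ck_on_const bounded_linear_imp_differentiable)
qed

lemma Ck_on_add:
  assumes S: "open S"
  shows "Ck_on k S f \<Longrightarrow> Ck_on k S g \<Longrightarrow> Ck_on k S (\<lambda>w. f w + g w)"
proof (induction k arbitrary: f g)
  case 0
  then show ?case by (auto intro: continuous_on_add)
next
  case (Suc k)
  have "Ck_on k S (dd h (\<lambda>w. f w + g w))" for h
    using Suc.IH Suc.prems
    by (subst Ck_on_cong[OF S, where g = "\<lambda>w. dd h f w + dd h g w"]) (auto simp: dd_add)
  with Suc.prems show ?case by auto
qed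

lemma Ck_on_mult:
  fixes f g :: "'a::euclidean_space \<Rightarrow> real"
  assumes S: "open S"
  shows "Ck_on k S f \<Longrightarrow> Ck_on k S g \<Longrightarrow> Ck_on k S (\<lambda>w. f w * g w)"
proof (induction k arbitrary: f g)
  case 0
  then show ?case by (auto intro: continuous_on_mult)
next
  case (Suc k)
  note C = Suc.prems[THEN Ck_on_SucD]
  have "Ck_on k S (dd h (\<lambda>w. f w * g w))" for h
    using Suc.IH Suc.prems C
    by (subst Ck_on_cong[OF S, where g = "\<lambda>w. f w * dd h g w + dd h f w * g w"])
       (auto simp: dd_mult intro!: Ck_on_add S)
  with Suc.prems show ?case by auto
qed

text \<open>The derivative of 1/f contains 1/f again; in the induction step this factor is already
  known to be of class C^k, which is all that is needed of it.\<close>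

lemma Ck_on_inverse:
  fixes f :: "'a::euclidean_space \<Rightarrow> real"
  assumes S: "open S" and nz: "\<And>w. w \<in> S \<Longrightarrow> f w \<noteq> 0"
  shows "Ck_on k S f \<Longrightarrow> Ck_on k S (\<lambda>w. inverse (f w))"
proof (induction k)
  case 0
  then show ?case using nz by (auto intro: continuous_on_inverse)
next
  case (Suc k)
  have inv: "Ck_on k S (\<lambda>w. inverse (f w))" using Suc Ck_on_SucD by blast
  have d: "dd h (\<lambda>w. inverse (f w)) z = (-1) * ((inverse (f z) * dd h f z) * inverse (f z))"
    if "z \<in> S" for h z
  proof (rule dd_eqI[THEN trans])
    show "((\<lambda>w. inverse (f w)) has_derivative
        (\<lambda>h. - (inverse (f z) * dd h f z * inverse (f z)))) (at z)"
      using Suc.prems nz that by (intro Deriv.has_derivative_inverse has_derivative_dd) auto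
  qed simp
  have "Ck_on k S (dd h (\<lambda>w. inverse (f w)))" for h
    using Suc.prems inv
    by (subst Ck_on_cong[OF S d]) (assumption, intro Ck_on_mult Ck_on_const S, simp_all)
  with Suc.prems nz show ?case by (auto intro!: differentiable_inverse)
qed

lemma smooth_on_cong:
  "open S \<Longrightarrow> (\<And>w. w \<in> S \<Longrightarrow> f w = g w) \<Longrightarrow> smooth_on S f \<longleftrightarrow> smooth_on S g"
  unfolding smooth_on_def using Ck_on_cong[of S f g] by blast

lemma smooth_on_differentiable: "smooth_on S f \<Longrightarrow> z \<in> S \<Longrightarrow> f differentiable (at z)"
  unfolding smooth_on_def by (drule spec[of _ "Suc 0"]) (simp only: Ck_on.simps(2))

lemma smooth_on_dd: "smooth_on S f \<Longrightarrow> smooth_on S (dd h f)"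
proof -
  assume "smooth_on S f"
  then have "Ck_on (Suc k) S f" for k unfolding smooth_on_def by blast
  then have "Ck_on k S (dd h f)" for k using Ck_on.simps(2) by blast
  then show ?thesis by (simp add: smooth_on_def)
qed

lemma smooth_on_const: "smooth_on S (\<lambda>_. c)"
  by (simp add: smooth_on_def Ck_on_const)

lemma smooth_on_bounded_linear: "bounded_linear f \<Longrightarrow> smooth_on S f"
  by (simp add: smooth_on_def Ck_on_bounded_linear)

lemma smooth_on_add:
  "open S \<Longrightarrow> smooth_on S f \<Longrightarrow> smooth_on S g \<Longrightarrow> smooth_on S (\<lambda>w. f w + g w)"
  by (simp add: smooth_on_def Ck_on_add)

lemma smooth_on_mult:
  fixes f g :: "'a::euclidean_space \<Rightarrow> real"
  shows "open S \<Longrightarrow> smooth_on S f \<Longrightarrow> smooth_on S g \<Longrightarrow> smooth_on S (\<lambda>w. f w * g w)"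
  by (simp add: smooth_on_def Ck_on_mult)

lemma smooth_on_inverse:
  fixes f :: "'a::euclidean_space \<Rightarrow> real"
  shows "open S \<Longrightarrow> (\<And>w. w \<in> S \<Longrightarrow> f w \<noteq> 0) \<Longrightarrow> smooth_on S f \<Longrightarrow>
    smooth_on S (\<lambda>w. inverse (f w))"
  by (simp add: smooth_on_def Ck_on_inverse)

lemma smooth_on_minus:
  fixes f :: "'a::euclidean_space \<Rightarrow> real"
  shows "open S \<Longrightarrow> smooth_on S f \<Longrightarrow> smooth_on S (\<lambda>w. - f w)"
  using smooth_on_mult[of S "\<lambda>_. -1" f] by (simp add: smooth_on_const)

lemma smooth_on_diff:
  fixes f g :: "'a::euclidean_space \<Rightarrow> real"
  shows "open S \<Longrightarrow> smooth_on S f \<Longrightarrow> smooth_on S g \<Longrightarrow> smooth_on S (\<lambda>w. f w - g w)"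
  using smooth_on_add[of S f "\<lambda>w. - g w"] by (simp add: smooth_on_minus)

lemma smooth_on_sum:
  "open S \<Longrightarrow> (\<And>i. i \<in> I \<Longrightarrow> smooth_on S (f i)) \<Longrightarrow> smooth_on S (\<lambda>w. \<Sum>i\<in>I. f i w)"
  by (induction I rule: infinite_finite_induct) (auto intro: smooth_on_const smooth_on_add)

lemma smooth_on_prod:
  fixes f :: "'i \<Rightarrow> 'a::euclidean_space \<Rightarrow> real"
  shows "open S \<Longrightarrow> (\<And>i. i \<in> I \<Longrightarrow> smooth_on S (f i)) \<Longrightarrow> smooth_on S (\<lambda>w. \<Prod>i\<in>I. f i w)"
  by (induction I rule: infinite_finite_induct) (auto intro: smooth_on_const smooth_on_mult)

lemmas smooth_intros = smooth_on_const smooth_on_add smooth_on_mult smooth_on_minus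
  smooth_on_diff smooth_on_sum smooth_on_prod smooth_on_dd

section \<open>Smoothness of matrix inverses\<close>

lemma matrix_inv_mult:
  fixes A :: "real ^ 'n ^ 'n"
  assumes "det A \<noteq> 0"
  shows "A ** matrix_inv A = mat 1" "matrix_inv A ** A = mat 1"
proof -
  have "\<exists>B. A ** B = mat 1 \<and> B ** A = mat 1"
    using assms by (simp add: invertible_det_nz[symmetric] invertible_def)
  from someI_ex[OF this] show "A ** matrix_inv A = mat 1" "matrix_inv A ** A = mat 1"
    by (auto simp: matrix_inv_def)
qed

text \<open>Cramer's rule makes each entry of the inverse a quotient of determinants, so smoothness
  of the inverse reduces to sums, products and one reciprocal.\<close>

lemma matrix_inv_cramer:
  fixes A :: "real ^ 'n ^ 'n"
  assumes "det A \<noteq> 0"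
  shows "matrix_inv A $ i $ j = det (\<chi> a b. if b = i then axis j 1 $ a else A $ a $ b) / det A"
proof -
  have "A *v (matrix_inv A *v axis j 1) = axis j 1"
    using assms
    by (simp add: matrix_vector_mul_assoc matrix_inv_mult)
  then have "(matrix_inv A *v axis j 1) $ i =
      det (\<chi> a b. if b = i then axis j 1 $ a else A $ a $ b) / det A"
    using cramer[OF assms, of "matrix_inv A *v axis j 1" "axis j 1"]
    by (metis (no_types, lifting) vec_lambda_beta)
  then show ?thesis by (simp add: matrix_vector_mult_basis column_def)
qed

lemma smooth_on_det:
  fixes B :: "'a::euclidean_space \<Rightarrow> real ^ 'n ^ 'n"
  assumes "open S" "\<And>i j. smooth_on S (\<lambda>w. B w $ i $ j)"
  shows "smooth_on S (\<lambda>w. det (B w))"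
  unfolding det_def using assms by (intro smooth_intros)

lemma smooth_on_matrix_inv:
  fixes B :: "'a::euclidean_space \<Rightarrow> real ^ 'n ^ 'n"
  assumes S: "open S" and B: "\<And>i j. smooth_on S (\<lambda>w. B w $ i $ j)"
    and nz: "\<And>w. w \<in> S \<Longrightarrow> det (B w) \<noteq> 0"
  shows "smooth_on S (\<lambda>w. matrix_inv (B w) $ i $ j)"
proof -
  have "smooth_on S (\<lambda>w. (\<chi> a b. if b = i then axis j 1 $ a else B w $ a $ b) $ a $ b)" for a b
    using B by (cases "b = i") (auto intro: smooth_on_const)
  then have "smooth_on S (\<lambda>w. det (\<chi> a b. if b = i then axis j 1 $ a else B w $ a $ b)
      * inverse (det (B w)))"
    by (intro smooth_on_mult smooth_on_inverse smooth_on_det S B nz)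
  then show ?thesis
    by (subst smooth_on_cong[OF S]) (auto simp: matrix_inv_cramer nz divide_inverse)
qed

section \<open>Symmetry of second derivatives\<close>

lemma has_real_derivative_line:
  assumes "f differentiable (at (x + a *\<^sub>R h + c))"
  shows "((\<lambda>a. f (x + a *\<^sub>R h + c)) has_real_derivative dd h f (x + a *\<^sub>R h + c)) (at a)"
proof -
  have "((\<lambda>a. f (x + a *\<^sub>R h + c)) has_derivative
      (\<lambda>t. dd (t *\<^sub>R h) f (x + a *\<^sub>R h + c))) (at a)"
    by (rule has_derivative_compose[where g = f and f = "\<lambda>a. x + a *\<^sub>R h + c", OF _ has_derivative_dd[OF assms]])
       (auto intro!: derivative_eq_intros)
  moreover have "dd (t *\<^sub>R h) f (x + a *\<^sub>R h + c) = dd h f (x + a *\<^sub>R h + c) * t" for t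
    using linear_cmul[OF linear_dd[OF assms]] by simp
  ultimately show ?thesis by (simp add: has_field_derivative_def)
qed

text \<open>The second difference is the increment over [0, t] of a -> f(x + a h + t k) - f(x + a
  h). The mean value theorem leaves a difference in direction \<open>k\<close>, to which it applies
  once more.\<close>

lemma second_difference_mvt:
  assumes f: "smooth_on S f" and t: "0 < t"
    and sub: "\<And>a b. 0 \<le> a \<Longrightarrow> a \<le> t \<Longrightarrow> 0 \<le> b \<Longrightarrow> b \<le> t \<Longrightarrow> x + a *\<^sub>R h + b *\<^sub>R k \<in> S"
  shows "\<exists>a b. 0 < a \<and> a < t \<and> 0 < b \<and> b < t \<and>
    f (x + t *\<^sub>R h + t *\<^sub>R k) - f (x + t *\<^sub>R h) - f (x + t *\<^sub>R k) + f x
      = t\<^sup>2 * dd k (dd h f) (x + a *\<^sub>R h + b *\<^sub>R k)"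
proof -
  have f': "smooth_on S (dd h f)" by (rule smooth_on_dd[OF f])
  \<comment> \<open>The added \<open>0\<close> gives both terms the shape
    \<open>x + a *\<^sub>R h + c\<close> of \<open>has_real_derivative_line\<close>.\<close>
  let ?\<phi> = "\<lambda>a. f (x + a *\<^sub>R h + t *\<^sub>R k) - f (x + a *\<^sub>R h + 0)"
  have "\<exists>a. 0 < a \<and> a < t \<and> ?\<phi> t - ?\<phi> 0 =
      (t - 0) * (dd h f (x + a *\<^sub>R h + t *\<^sub>R k) - dd h f (x + a *\<^sub>R h + 0))"
  proof (intro MVT2[OF t] DERIV_diff has_real_derivative_line)
    fix a assume "0 \<le> a" "a \<le> t"
    then show "f differentiable at (x + a *\<^sub>R h + t *\<^sub>R k)"
        "f differentiable at (x + a *\<^sub>R h + 0)"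
      using sub[of a t] sub[of a 0] t by (auto intro: smooth_on_differentiable[OF f])
  qed
  then obtain a where a: "0 < a" "a < t"
    and 1: "?\<phi> t - ?\<phi> 0 = t * (dd h f (x + a *\<^sub>R h + t *\<^sub>R k) - dd h f (x + a *\<^sub>R h))"
    by auto
  let ?\<psi> = "\<lambda>b. dd h f ((x + a *\<^sub>R h) + b *\<^sub>R k + 0)"
  have "\<exists>b. 0 < b \<and> b < t \<and> ?\<psi> t - ?\<psi> 0 =
      (t - 0) * dd k (dd h f) ((x + a *\<^sub>R h) + b *\<^sub>R k + 0)"
  proof (intro MVT2[OF t] has_real_derivative_line)
    fix b assume "0 \<le> b" "b \<le> t"
    then show "dd h f differentiable at ((x + a *\<^sub>R h) + b *\<^sub>R k + 0)"
      using sub[of a b] a by (auto intro: smooth_on_differentiable[OF f'])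
  qed
  then obtain b where b: "0 < b" "b < t"
    and 2: "?\<psi> t - ?\<psi> 0 = t * dd k (dd h f) (x + a *\<^sub>R h + b *\<^sub>R k)"
    by auto
  have "?\<phi> t - ?\<phi> 0 = t\<^sup>2 * dd k (dd h f) (x + a *\<^sub>R h + b *\<^sub>R k)"
    using 1 2 by (simp add: power2_eq_square)
  with a b show ?thesis
    by (intro exI[of _ a] exI[of _ b]) (simp add: algebra_simps)
qed

text \<open>The second difference is unchanged when \<open>h\<close> and \<open>k\<close> are
  exchanged, so one mixed derivative at some point near \<open>x\<close> equals the other at another
  such point; continuity at \<open>x\<close> does the rest.\<close>

lemma dd_commute:
  fixes f :: "'a::euclidean_space \<Rightarrow> real"
  assumes S: "open S" and f: "smooth_on S f" and x: "x \<in> S"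
  shows "dd k (dd h f) x = dd h (dd k f) x"
proof (rule ccontr)
  assume ne: "dd k (dd h f) x \<noteq> dd h (dd k f) x"
  \<comment> \<open>Half the supposed gap: no number is closer than this to both mixed derivatives
    at \<open>x\<close>.\<close>
  define \<epsilon> where "\<epsilon> = \<bar>dd k (dd h f) x - dd h (dd k f) x\<bar> / 2"
  have \<epsilon>: "\<epsilon> > 0" using ne by (simp add: \<epsilon>_def)
  have cont: "isCont (dd u (dd w f)) x" for u w
    by (intro differentiable_imp_continuous_within smooth_on_differentiable[OF _ x]
        smooth_on_dd f)
  have "\<exists>e>0. \<forall>y. dist y x < e \<longrightarrow> dist (dd k (dd h f) y) (dd k (dd h f) x) < \<epsilon>"
    using cont[where u = k and w = h] \<epsilon> unfolding continuous_at_eps_delta by simp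
  then obtain e1 where e1: "e1 > 0"
    "\<forall>y. dist y x < e1 \<longrightarrow> dist (dd k (dd h f) y) (dd k (dd h f) x) < \<epsilon>"
    by (elim exE conjE)
  have "\<exists>e>0. \<forall>y. dist y x < e \<longrightarrow> dist (dd h (dd k f) y) (dd h (dd k f) x) < \<epsilon>"
    using cont[where u = h and w = k] \<epsilon> unfolding continuous_at_eps_delta by simp
  then obtain e2 where e2: "e2 > 0"
    "\<forall>y. dist y x < e2 \<longrightarrow> dist (dd h (dd k f) y) (dd h (dd k f) x) < \<epsilon>"
    by (elim exE conjE)
  obtain e3 where e3: "e3 > 0" "ball x e3 \<subseteq> S"
    using S x open_contains_ball by blast
  define e where "e = min e1 (min e2 e3)"
  have e: "e > 0" "e \<le> e1" "e \<le> e2" "e \<le> e3" using e1 e2 e3 by (auto simp: e_def)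
  \<comment> \<open>Keeps x + a h + b k within e/2 of \<open>x\<close> for a, b \<le> t; the summand
    1 guards against h = k = 0.\<close>
  define t where "t = e / (2 * (norm h + norm k + 1))"
  have nn: "norm h + norm k + 1 > 0" by (smt (verit) norm_ge_zero)
  have t: "t > 0" using e nn by (simp add: t_def)
  have near: "dist (x + a *\<^sub>R h + b *\<^sub>R k) x < e"
    if "0 \<le> a" "a \<le> t" "0 \<le> b" "b \<le> t" for a b
  proof -
    have "dist (x + a *\<^sub>R h + b *\<^sub>R k) x = norm (a *\<^sub>R h + b *\<^sub>R k)"
      by (simp add: dist_norm algebra_simps)
    also have "\<dots> \<le> a * norm h + b * norm k"
      using norm_triangle_ineq[of "a *\<^sub>R h" "b *\<^sub>R k"] that by simp
    also have "\<dots> \<le> t * norm h + t * norm k"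
      using that by (intro add_mono mult_right_mono) auto
    also have "\<dots> \<le> t * (norm h + norm k + 1)" using t by (simp add: algebra_simps)
    also have "\<dots> = e / 2" using nn by (simp add: t_def field_simps)
    also have "\<dots> < e" using e by simp
    finally show ?thesis .
  qed
  have sub: "x + a *\<^sub>R h + b *\<^sub>R k \<in> S" if "0 \<le> a" "a \<le> t" "0 \<le> b" "b \<le> t" for a b
    using near[OF that] e e3 by (auto simp: subset_iff dist_commute)
  have sub': "x + b *\<^sub>R k + a *\<^sub>R h \<in> S" if "0 \<le> b" "b \<le> t" "0 \<le> a" "a \<le> t" for a b
    using sub[of a b] that by (simp add: algebra_simps)
  have "\<exists>a b. 0 < a \<and> a < t \<and> 0 < b \<and> b < t \<and>
    f (x + t *\<^sub>R h + t *\<^sub>R k) - f (x + t *\<^sub>R h) - f (x + t *\<^sub>R k) + f x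
      = t\<^sup>2 * dd k (dd h f) (x + a *\<^sub>R h + b *\<^sub>R k)"
    by (rule second_difference_mvt[OF f t]) (rule sub)
  then obtain a b where ab: "0 < a" "a < t" "0 < b" "b < t"
    and 1: "f (x + t *\<^sub>R h + t *\<^sub>R k) - f (x + t *\<^sub>R h) - f (x + t *\<^sub>R k) + f x
      = t\<^sup>2 * dd k (dd h f) (x + a *\<^sub>R h + b *\<^sub>R k)"
    by (elim exE conjE)
  have "\<exists>b a. 0 < b \<and> b < t \<and> 0 < a \<and> a < t \<and>
    f (x + t *\<^sub>R k + t *\<^sub>R h) - f (x + t *\<^sub>R k) - f (x + t *\<^sub>R h) + f x
      = t\<^sup>2 * dd h (dd k f) (x + b *\<^sub>R k + a *\<^sub>R h)"
    by (rule second_difference_mvt[OF f t]) (rule sub')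
  then obtain b' a' where ab': "0 < b'" "b' < t" "0 < a'" "a' < t"
    and 2: "f (x + t *\<^sub>R k + t *\<^sub>R h) - f (x + t *\<^sub>R k) - f (x + t *\<^sub>R h) + f x
      = t\<^sup>2 * dd h (dd k f) (x + b' *\<^sub>R k + a' *\<^sub>R h)"
    by (elim exE conjE)
  have swap: "x + s *\<^sub>R k + r *\<^sub>R h = x + r *\<^sub>R h + s *\<^sub>R k" for r s
    by (simp add: ac_simps)
  have "t\<^sup>2 * dd k (dd h f) (x + a *\<^sub>R h + b *\<^sub>R k) = t\<^sup>2 * dd h (dd k f) (x + a' *\<^sub>R h + b' *\<^sub>R k)"
    using 1 2 unfolding swap by linarith
  then have eq: "dd k (dd h f) (x + a *\<^sub>R h + b *\<^sub>R k) = dd h (dd k f) (x + a' *\<^sub>R h + b' *\<^sub>R k)"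
    using t by simp
  have "dist (dd k (dd h f) (x + a *\<^sub>R h + b *\<^sub>R k)) (dd k (dd h f) x) < \<epsilon>"
    using near[of a b] ab e by (intro e1(2)[rule_format]) auto
  moreover have "dist (dd h (dd k f) (x + a' *\<^sub>R h + b' *\<^sub>R k)) (dd h (dd k f) x) < \<epsilon>"
    using near[of a' b'] ab' e by (intro e2(2)[rule_format]) auto
  moreover have "\<bar>u - p\<bar> < \<bar>p - q\<bar> / 2 \<Longrightarrow> \<bar>u - q\<bar> < \<bar>p - q\<bar> / 2 \<Longrightarrow> False" for u p q :: real
    by (cases "p \<le> q") (auto simp: abs_real_def split: if_splits)
  ultimately show False unfolding eq dist_real_def \<epsilon>_def by blast
qed

section \<open>Vector fields as first-order operators\<close>

lemma dd_vec_expansion: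
  fixes f :: "'a::euclidean_space \<Rightarrow> real"
  assumes "f differentiable (at z)"
  shows "dd h f z = (\<Sum>b\<in>Basis. (h \<bullet> b) * dd b f z)"
proof -
  have "dd (\<Sum>b\<in>Basis. (h \<bullet> b) *\<^sub>R b) f z = (\<Sum>b\<in>Basis. (h \<bullet> b) * dd b f z)"
    using linear_dd[OF assms] by (simp add: linear_sum linear_cmul)
  then show ?thesis by (simp add: euclidean_representation)
qed

lemma dd_inner:
  fixes W :: "'a::real_normed_vector \<Rightarrow> 'b::real_inner"
  assumes "W differentiable (at z)"
  shows "dd k (\<lambda>w. W w \<bullet> b) z = dd k W z \<bullet> b"
  by (rule dd_eqI) (intro has_derivative_inner_left has_derivative_dd assms)

lemma dd_along_field:
  fixes f :: "'a::euclidean_space \<Rightarrow> real"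
  assumes S: "open S" and f: "smooth_on S f" and z: "z \<in> S" and W: "W differentiable (at z)"
  shows "dd k (\<lambda>w. dd (W w) f w) z = dd (dd k W z) f z + dd k (dd (W z) f) z"
proof -
  have d: "dd b f differentiable (at z)" for b
    by (intro smooth_on_differentiable[OF _ z] smooth_on_dd f)
  have fd: "f differentiable (at w)" if "w \<in> S" for w
    using smooth_on_differentiable[OF f that] .
  have Wd: "(\<lambda>w. W w \<bullet> b) differentiable (at z)" for b
    using W by (intro differentiable_inner) auto
  have "dd k (\<lambda>w. dd (W w) f w) z = dd k (\<lambda>w. \<Sum>b\<in>Basis. (W w \<bullet> b) * dd b f w) z"
    by (rule dd_cong[OF S z]) (rule dd_vec_expansion[OF fd])
  also have "\<dots> = (\<Sum>b\<in>Basis. (W z \<bullet> b) * dd k (dd b f) z + (dd k W z \<bullet> b) * dd b f z)"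
    using d Wd W by (simp add: dd_sum dd_mult dd_inner)
  also have "\<dots> = dd (dd k W z) f z + (\<Sum>b\<in>Basis. (W z \<bullet> b) * dd k (dd b f) z)"
    by (simp add: dd_vec_expansion[OF fd[OF z], of "dd k W z"] sum.distrib)
  also have "(\<Sum>b\<in>Basis. (W z \<bullet> b) * dd k (dd b f) z) =
      dd k (\<lambda>w. \<Sum>b\<in>Basis. (W z \<bullet> b) * dd b f w) z"
    using d by (simp add: dd_sum dd_cmult)
  also have "\<dots> = dd k (dd (W z) f) z"
    by (rule dd_cong[OF S z]) (rule dd_vec_expansion[OF fd, symmetric])
  finally show ?thesis .
qed

text \<open>The second-order parts are the two mixed derivatives in the directions
  \<open>V z\<close> and \<open>W z\<close>, and they cancel. Bracket relations thereby become
  commutation rules for operators, which can be composed.\<close>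

lemma commutator_eq_lie_bracket:
  fixes f :: "'a::euclidean_space \<Rightarrow> real"
  assumes S: "open S" and f: "smooth_on S f" and z: "z \<in> S"
    and V: "V differentiable (at z)" and W: "W differentiable (at z)"
  shows "dd (V z) (\<lambda>w. dd (W w) f w) z - dd (W z) (\<lambda>w. dd (V w) f w) z
    = dd (lie_bracket V W z) f z"
  unfolding dd_along_field[OF S f z W] dd_along_field[OF S f z V] lie_bracket_def
    linear_diff[OF linear_dd[OF smooth_on_differentiable[OF f z]]]
    dd_commute[OF S f z, of "V z" "W z"]
  by simp

section \<open>Cartan geometry in one chart\<close>

abbreviation bv :: "'n \<Rightarrow> 'n::finite coords" where "bv i \<equiv> (axis i 1, 0)"
abbreviation fv :: "'n \<Rightarrow> 'n::finite coords" where "fv i \<equiv> (0, axis i 1)"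

lemma dd_expand:
  fixes f :: "'n::finite coords \<Rightarrow> real"
  assumes "f differentiable (at z)"
  shows "dd h f z = (\<Sum>i\<in>UNIV. fst h $ i * dd (bv i) f z) + (\<Sum>i\<in>UNIV. snd h $ i * dd (fv i) f z)"
proof -
  have h: "h = (\<Sum>i\<in>UNIV. fst h $ i *\<^sub>R bv i) + (\<Sum>i\<in>UNIV. snd h $ i *\<^sub>R fv i)"
    by (simp add: prod_eq_iff fst_sum snd_sum vec_eq_iff axis_def if_distrib[of "\<lambda>x. _ * x"]
        cong: if_cong)
  have "dd ((\<Sum>i\<in>UNIV. fst h $ i *\<^sub>R bv i) + (\<Sum>i\<in>UNIV. snd h $ i *\<^sub>R fv i)) f z =
      (\<Sum>i\<in>UNIV. fst h $ i * dd (bv i) f z) + (\<Sum>i\<in>UNIV. snd h $ i * dd (fv i) f z)"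
    using linear_dd[OF assms]
    by (simp only: linear_add linear_sum linear_cmul real_scaleR_def)
  then show ?thesis by (simp only: h[symmetric])
qed

lemma dd_vertical:
  fixes f :: "'n::finite coords \<Rightarrow> real"
  assumes "f differentiable (at z)"
  shows "dd (0, u) f z = (\<Sum>i\<in>UNIV. u $ i * dd (fv i) f z)"
  using dd_expand[OF assms, of "(0, u)"] by simp

lemma bounded_linear_snd_nth: "bounded_linear (\<lambda>w::'n::finite coords. snd w $ j)"
  by (rule bounded_linear_compose[OF bounded_linear_vec_nth bounded_linear_snd])

lemma dd_momentum: "dd h (\<lambda>w::'n::finite coords. snd w $ j) z = snd h $ j"
  by (rule dd_bounded_linear[OF bounded_linear_snd_nth])

text \<open>Differentiate f(x, r p) = r^d f(x, p) with respect to r at r = 1.\<close>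

lemma euler_homogeneous:
  fixes f :: "'n::finite coords \<Rightarrow> real"
  assumes f: "f differentiable (at z)"
    and hom: "\<And>r. r > 0 \<Longrightarrow> f (fst z, r *\<^sub>R snd z) = r ^ d * f z"
  shows "dd (0, snd z) f z = d * f z"
proof -
  let ?c = "\<lambda>r::real. (fst z, r *\<^sub>R snd z)"
  have "((\<lambda>r. f (?c r)) has_derivative (\<lambda>t. dd (0, t *\<^sub>R snd z) f z)) (at 1)"
  proof (rule has_derivative_compose[of ?c])
    show "(?c has_derivative (\<lambda>t. (0, t *\<^sub>R snd z))) (at 1)"
      by (auto intro!: derivative_eq_intros has_derivative_Pair)
    show "(f has_derivative (\<lambda>h. dd h f z)) (at (fst z, 1 *\<^sub>R snd z))"
      using has_derivative_dd[OF f] by simp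
  qed
  then have "((\<lambda>r. r ^ d * f z) has_derivative (\<lambda>t. dd (0, t *\<^sub>R snd z) f z)) (at 1)"
    by (rule has_derivative_transform_within_open[where s = "{0<..}"]) (auto simp: hom)
  moreover have "((\<lambda>r. r ^ d * f z) has_derivative (\<lambda>t. t * (d * f z))) (at 1)"
    by (auto intro!: derivative_eq_intros simp: algebra_simps)
  ultimately have "(\<lambda>t. dd (0, t *\<^sub>R snd z) f z) = (\<lambda>t. t * (d * f z))"
    by (rule has_derivative_unique)
  from fun_cong[OF this, of 1] show ?thesis by simp
qed

lemma det_nonzero_if_ker_trivial:
  fixes A :: "real ^ 'n ^ 'n"
  assumes "\<And>x. A *v x = 0 \<Longrightarrow> x = 0"
  shows "det A \<noteq> 0"
  using assms
  by (metis invertible_det_nz invertible_left_inverse matrix_left_invertible_ker)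

text \<open>\<open>U\<close> stands for a chart image and \<open>L\<close> for the local
  representative of K; the local geometry sees nothing else of the manifold.\<close>

locale cartan_chart =
  fixes U :: "(real ^ 'n::finite) set" and L :: "'n coords \<Rightarrow> real"
  assumes open_U: "open U"
    and smooth_L: "smooth_on (U \<times> - {0}) L"
    and homogeneous_L: "\<And>x p r. x \<in> U \<Longrightarrow> p \<noteq> 0 \<Longrightarrow> r > 0 \<Longrightarrow> L (x, r *\<^sub>R p) = r * L (x, p)"
    and pos_def: "\<And>z \<xi>. z \<in> U \<times> - {0} \<Longrightarrow> \<xi> \<noteq> 0 \<Longrightarrow> 0 < \<xi> \<bullet> (gup L z *v \<xi>)"
begin

definition "S = U \<times> - {0 :: real ^ 'n}"

text \<open>The energy K^2/2 in the role of a Hamiltonian; its momentum gradient \<open>pu\<close>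
  is p^i and its momentum Hessian is g^{ij}.\<close>

definition H :: "'n coords \<Rightarrow> real" where "H w = tau (L w)"

definition pu :: "'n \<Rightarrow> 'n coords \<Rightarrow> real" where "pu i = dd (fv i) H"

abbreviation gu :: "'n \<Rightarrow> 'n \<Rightarrow> 'n coords \<Rightarrow> real" where "gu i j z \<equiv> gup L z $ i $ j"
abbreviation gl :: "'n \<Rightarrow> 'n \<Rightarrow> 'n coords \<Rightarrow> real" where "gl i j z \<equiv> glow L z $ i $ j"

lemma open_S: "open S"
  unfolding S_def using open_U by (intro open_Times) auto

lemma smooth_H: "smooth_on S H"
  unfolding H_def tau_def power2_eq_square
  using smooth_L by (intro smooth_intros open_S) (auto simp: S_def)

lemma smooth_pu: "smooth_on S (pu i)"
  unfolding pu_def by (intro smooth_intros smooth_H)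

lemma gu_eq:
  assumes z: "z \<in> S"
  shows "gu i j z = dd (fv i) (pu j) z"
proof -
  have L2: "smooth_on S (\<lambda>w. (L w)\<^sup>2)"
    unfolding power2_eq_square using smooth_L by (intro smooth_intros open_S) (auto simp: S_def)
  have H_eq: "H = (\<lambda>w. 1/2 * (L w)\<^sup>2)" by (simp add: fun_eq_iff H_def tau_def)
  have "pu j w = 1/2 * dd (fv j) (\<lambda>w. (L w)\<^sup>2) w" if "w \<in> S" for w
    using smooth_on_differentiable[OF L2 that] by (simp only: pu_def H_eq dd_cmult)
  then have "dd (fv i) (pu j) z = dd (fv i) (\<lambda>w. 1/2 * dd (fv j) (\<lambda>w. (L w)\<^sup>2) w) z"
    by (rule dd_cong[OF open_S z])
  also have "\<dots> = 1/2 * dd (fv i) (dd (fv j) (\<lambda>w. (L w)\<^sup>2)) z"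
    by (intro dd_cmult smooth_on_differentiable[OF _ z] smooth_on_dd L2)
  finally show ?thesis by (simp add: gup_def fpartial_def[abs_def])
qed

lemma smooth_gu: "smooth_on S (gu i j)"
  by (subst smooth_on_cong[OF open_S gu_eq]) (auto intro: smooth_on_dd smooth_pu)

lemma gu_sym: "z \<in> S \<Longrightarrow> gu i j z = gu j i z"
  unfolding gu_eq unfolding pu_def by (rule dd_commute[OF open_S smooth_H])

lemma det_gup: "z \<in> S \<Longrightarrow> det (gup L z) \<noteq> 0"
  using pos_def[of z] by (intro det_nonzero_if_ker_trivial) (force simp: S_def)

lemma smooth_gl: "smooth_on S (gl i j)"
  unfolding glow_def by (intro smooth_on_matrix_inv open_S smooth_gu det_gup)

lemma gl_gu: "z \<in> S \<Longrightarrow> (\<Sum>k\<in>UNIV. gl i k z * gu k j z) = (if i = j then 1 else 0)"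
  using matrix_inv_mult(2)[OF det_gup, of z]
  by (simp add: glow_def vec_eq_iff matrix_matrix_mult_def mat_def)

lemma gl_sym:
  assumes z: "z \<in> S"
  shows "gl i j z = gl j i z"
proof -
  have tg: "transpose (gup L z) = gup L z"
    using gu_sym[OF z] by (simp add: vec_eq_iff transpose_def)
  have "transpose (glow L z) ** gup L z = mat 1"
    using matrix_inv_mult(1)[OF det_gup[OF z]]
    by (metis glow_def matrix_transpose_mul tg transpose_mat)
  then have "transpose (glow L z) = glow L z"
    using matrix_inv_mult(1)[OF det_gup[OF z]]
    by (metis glow_def matrix_mul_assoc matrix_mul_lid matrix_mul_rid)
  then show ?thesis by (metis transpose_def vec_lambda_beta)
qed

lemma sum_delta_left: "(\<Sum>c\<in>UNIV. (if i = c then 1 else 0) * f c) = (f i :: real)" for i :: 'n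
  by (simp add: if_distrib[of "\<lambda>x. x * _"] cong: if_cong)

lemma lower_raise:
  assumes "z \<in> S"
  shows "(\<Sum>b\<in>UNIV. gl i b z * (\<Sum>c\<in>UNIV. gu b c z * f c)) = f i"
proof -
  have "(\<Sum>b\<in>UNIV. gl i b z * (\<Sum>c\<in>UNIV. gu b c z * f c)) =
      (\<Sum>c\<in>UNIV. (\<Sum>b\<in>UNIV. gl i b z * gu b c z) * f c)"
    unfolding sum_distrib_left sum_distrib_right by (subst sum.swap) (simp add: mult.assoc)
  then show ?thesis by (simp only: gl_gu[OF assms] sum_delta_left)
qed

subsection \<open>Homogeneity\<close>

definition dil :: "real \<Rightarrow> 'n coords \<Rightarrow> 'n coords" where "dil r z = (fst z, r *\<^sub>R snd z)"

text \<open>A factor \<open>c\<close> at one fixed \<open>r\<close> stands in for a degree of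
  homogeneity: momentum derivatives divide it by \<open>r\<close>, so a negative degree, such as
  that of \<partial>^h g_ij, is handled like any other.\<close>

definition scales :: "real \<Rightarrow> real \<Rightarrow> ('n coords \<Rightarrow> real) \<Rightarrow> bool" where
  "scales r c f \<longleftrightarrow> (\<forall>z\<in>S. f (dil r z) = c * f z)"

lemma dil_in_S: "r > 0 \<Longrightarrow> z \<in> S \<Longrightarrow> dil r z \<in> S"
  by (auto simp: dil_def S_def)

text \<open>Chain rule for f(dil r w) = c f(w), where the linear map \<open>dil r\<close> is its own
  derivative. It fixes base directions and multiplies momentum directions by \<open>r\<close>,
  whence the two rules that follow.\<close>

lemma dd_dil:
  assumes f: "smooth_on S f" and sc: "scales r c f" and r: "r > 0" and z: "z \<in> S"
  shows "dd (dil r h) f (dil r z) = c * dd h f z"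
proof -
  have "((\<lambda>w. f (dil r w)) has_derivative (\<lambda>h. dd (dil r h) f (dil r z))) (at z)"
  proof (rule has_derivative_compose[of "dil r"])
    show "(dil r has_derivative dil r) (at z)"
      unfolding dil_def by (auto intro!: derivative_eq_intros)
    show "(f has_derivative (\<lambda>h. dd h f (dil r z))) (at (dil r z))"
      by (intro has_derivative_dd smooth_on_differentiable[OF f] dil_in_S r z)
  qed
  then have "dd h (\<lambda>w. f (dil r w)) z = dd (dil r h) f (dil r z)" by (rule dd_eqI)
  moreover have "dd h (\<lambda>w. f (dil r w)) z = dd h (\<lambda>w. c * f w) z"
    using sc by (intro dd_cong[OF open_S z]) (auto simp: scales_def)
  ultimately show ?thesis
    using smooth_on_differentiable[OF f z] by (simp add: dd_cmult)
qed

lemma scales_bv: "smooth_on S f \<Longrightarrow> scales r c f \<Longrightarrow> r > 0 \<Longrightarrow> scales r c (dd (bv i) f)"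
  using dd_dil[of f r c _ "bv i"] by (simp add: scales_def dil_def)

lemma scales_fv:
  assumes f: "smooth_on S f" and sc: "scales r c f" and r: "r > 0"
  shows "scales r (c / r) (dd (fv i) f)"
  unfolding scales_def
proof
  fix z assume z: "z \<in> S"
  have "dil r (fv i) = r *\<^sub>R fv i" by (simp add: dil_def)
  then have "r * dd (fv i) f (dil r z) = c * dd (fv i) f z"
    using dd_dil[OF f sc r z, of "fv i"]
      linear_cmul[OF linear_dd[OF smooth_on_differentiable[OF f dil_in_S[OF r z]]], of r "fv i"]
    by simp
  then show "dd (fv i) f (dil r z) = c / r * dd (fv i) f z" using r by (simp add: field_simps)
qed

lemma scales_H: "r > 0 \<Longrightarrow> scales r (r\<^sup>2) H"
  using homogeneous_L by (auto simp: scales_def H_def tau_def dil_def S_def power_mult_distrib)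

lemma scales_pu:
  assumes "r > 0" shows "scales r r (pu i)"
  using scales_fv[OF smooth_H scales_H[OF assms] assms] assms
  by (simp add: pu_def power2_eq_square)

lemma scales_gu: assumes r: "r > 0" shows "scales r 1 (gu i j)"
  using scales_fv[OF smooth_pu scales_pu[OF r] r, of j i] r dil_in_S[OF r]
  by (simp add: scales_def gu_eq)

lemma scales_gl: assumes r: "r > 0" shows "scales r 1 (gl i j)"
proof -
  have "gup L (dil r z) = gup L z" if "z \<in> S" for z
    using scales_gu[OF r] that by (simp add: scales_def vec_eq_iff)
  then show ?thesis by (simp add: scales_def glow_def)
qed

lemma euler:
  assumes "smooth_on S f" "\<And>r. r > 0 \<Longrightarrow> scales r (r ^ d) f" "z \<in> S"
  shows "dd (0, snd z) f z = d * f z"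
  using assms(2,3) smooth_on_differentiable[OF assms(1,3)]
  by (intro euler_homogeneous) (auto simp: scales_def dil_def)

lemma euler_H: "z \<in> S \<Longrightarrow> dd (0, snd z) H z = 2 * H z"
  using euler[of H 2] smooth_H scales_H by simp

lemma euler_bv_H: "z \<in> S \<Longrightarrow> dd (0, snd z) (dd (bv i) H) z = 2 * dd (bv i) H z"
  using euler[of "dd (bv i) H" 2] scales_bv[OF smooth_H scales_H] smooth_on_dd[OF smooth_H] by simp

lemma euler_pu: "z \<in> S \<Longrightarrow> dd (0, snd z) (pu i) z = pu i z"
  using euler[of "pu i" 1] scales_pu smooth_pu by simp

lemma euler_gl: "z \<in> S \<Longrightarrow> dd (0, snd z) (gl i j) z = 0"
  using euler[of "gl i j" 0] scales_gl smooth_gl by simp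

text \<open>The contraction g^{ij} p_j is the radial derivative of \<open>pu i\<close>, which is
  homogeneous of degree one.\<close>

lemma pup_eq:
  assumes z: "z \<in> S"
  shows "pup L z i = pu i z"
proof -
  have "pup L z i = (\<Sum>j\<in>UNIV. snd z $ j * dd (fv j) (pu i) z)"
    using gu_sym[OF z, of i] by (simp add: pup_def gu_eq[OF z, symmetric] mult.commute)
  also have "\<dots> = dd (0, snd z) (pu i) z"
    by (rule dd_vertical[symmetric]) (rule smooth_on_differentiable[OF smooth_pu z])
  finally show ?thesis by (simp add: euler_pu[OF z])
qed

lemma gu_p: "z \<in> S \<Longrightarrow> (\<Sum>j\<in>UNIV. gu i j z * snd z $ j) = pu i z"
  using pup_eq[of z i] by (simp add: pup_def)

lemma gl_pu: "z \<in> S \<Longrightarrow> (\<Sum>j\<in>UNIV. gl i j z * pu j z) = snd z $ i"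
  using lower_raise[of z i "\<lambda>c. snd z $ c"] by (simp add: gu_p)

lemma p_pu:
  assumes z: "z \<in> S"
  shows "(\<Sum>i\<in>UNIV. snd z $ i * pu i z) = 2 * H z"
  using dd_vertical[OF smooth_on_differentiable[OF smooth_H z], of "snd z"] euler_H[OF z]
  by (simp add: pu_def)

lemma H_pos:
  assumes z: "z \<in> S"
  shows "H z > 0"
proof -
  have "snd z \<bullet> (gup L z *v snd z) = 2 * H z"
    using p_pu[OF z] gu_p[OF z]
    by (simp add: inner_vec_def matrix_vector_mult_def)
  then show ?thesis using pos_def[of z "snd z"] z by (force simp: S_def)
qed

text \<open>Differentiate g_is p^s = p_i. This trades derivatives of the metric contracted with p^s
  for derivatives of p^s.\<close>

lemma dd_gl_pu:
  assumes z: "z \<in> S"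
  shows "(\<Sum>s\<in>UNIV. pu s z * dd h (gl i s) z) = snd h $ i - (\<Sum>s\<in>UNIV. gl i s z * dd h (pu s) z)"
proof -
  have "snd h $ i = dd h (\<lambda>w. \<Sum>s\<in>UNIV. gl i s w * pu s w) z"
    unfolding dd_momentum[where h = h and j = i and z = z, symmetric] by (rule dd_cong[OF open_S z]) (simp add: gl_pu)
  also have "\<dots> = (\<Sum>s\<in>UNIV. gl i s z * dd h (pu s) z + dd h (gl i s) z * pu s z)"
    using smooth_on_differentiable[OF smooth_gl z] smooth_on_differentiable[OF smooth_pu z]
    by (simp add: dd_sum dd_mult)
  finally show ?thesis by (simp add: sum.distrib mult.commute)
qed

text \<open>The derivative of an inverse matrix, d(A^{-1}) = - A^{-1} (dA) A^{-1}, from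
  differentiating \<open>gl_gu\<close>.\<close>

lemma dd_gl:
  assumes z: "z \<in> S"
  shows "dd h (gl i j) z = - (\<Sum>a\<in>UNIV. gl i a z * (\<Sum>b\<in>UNIV. dd h (gu a b) z * gl b j z))"
proof -
  note d = smooth_on_differentiable[OF smooth_gl z] smooth_on_differentiable[OF smooth_gu z]
  have *: "(\<Sum>a\<in>UNIV. dd h (gl i a) z * gu a b z) = - (\<Sum>a\<in>UNIV. gl i a z * dd h (gu a b) z)" for b
  proof -
    have "dd h (\<lambda>w. \<Sum>a\<in>UNIV. gl i a w * gu a b w) z = dd h (\<lambda>w. if i = b then 1 else 0) z"
      by (rule dd_cong[OF open_S z]) (simp add: gl_gu)
    then have "(\<Sum>a\<in>UNIV. gl i a z * dd h (gu a b) z + dd h (gl i a) z * gu a b z) = 0"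
      using d by (simp add: dd_sum dd_mult)
    then show ?thesis by (simp add: sum.distrib)
  qed
  have "dd h (gl i j) z = (\<Sum>b\<in>UNIV. gl j b z * (\<Sum>a\<in>UNIV. gu b a z * dd h (gl i a) z))"
    by (rule lower_raise[OF z, symmetric])
  also have "\<dots> = (\<Sum>b\<in>UNIV. gl b j z * (\<Sum>a\<in>UNIV. dd h (gl i a) z * gu a b z))"
    using gl_sym[OF z, of j] gu_sym[OF z] by (simp add: mult.commute)
  also have "\<dots> = - (\<Sum>b\<in>UNIV. \<Sum>a\<in>UNIV. gl b j z * (gl i a z * dd h (gu a b) z))"
    unfolding * by (simp add: sum_negf sum_distrib_left)
  also have "\<dots> = - (\<Sum>a\<in>UNIV. gl i a z * (\<Sum>b\<in>UNIV. dd h (gu a b) z * gl b j z))"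
    by (subst sum.swap) (simp add: sum_distrib_left mult_ac)
  finally show ?thesis .
qed

subsection \<open>The nonlinear connection\<close>

abbreviation N :: "'n \<Rightarrow> 'n \<Rightarrow> 'n coords \<Rightarrow> real" where "N \<equiv> nonlin_conn L"

lemmas smooth_basic = smooth_H smooth_pu smooth_gu smooth_gl

lemma diff_basic:
  assumes "z \<in> S"
  shows "H differentiable (at z)" "pu i differentiable (at z)"
    "(\<lambda>w. gu i j w) differentiable (at z)" "(\<lambda>w. gl i j w) differentiable (at z)"
    "dd h H differentiable (at z)" "dd h (pu i) differentiable (at z)"
  using assms by (auto intro!: smooth_on_differentiable[of S] smooth_basic smooth_on_dd)

section \<open>Vector fields by components and the geodesic spray\<close>

definition vf :: "('n \<Rightarrow> 'n coords \<Rightarrow> real) \<Rightarrow> ('n \<Rightarrow> 'n coords \<Rightarrow> real) \<Rightarrow> 'n coords \<Rightarrow> 'n coords" where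
  "vf F G z = ((\<chi> k. F k z), (\<chi> k. G k z))"

lemma has_derivative_vf:
  assumes "\<And>k. F k differentiable (at z)" "\<And>k. G k differentiable (at z)"
  shows "(vf F G has_derivative (\<lambda>h. ((\<chi> k. dd h (F k) z), (\<chi> k. dd h (G k) z)))) (at z)"
proof -
  have c: "((\<lambda>z. \<chi> k. F k z) has_derivative (\<lambda>h. \<chi> k. dd h (F k) z)) (at z)"
    if "\<And>k. F k differentiable (at z)" for F :: "'n \<Rightarrow> 'n coords \<Rightarrow> real"
    using that
    by (subst has_derivative_componentwise_within)
       (auto simp: Basis_vec_def inner_axis frechet_derivative_works[symmetric])
  show ?thesis
    unfolding vf_def by (intro has_derivative_Pair c assms)
qed

lemma differentiable_vf:
  assumes "\<And>k. F k differentiable (at z)" "\<And>k. G k differentiable (at z)"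
  shows "vf F G differentiable (at z)"
  using has_derivative_vf[OF assms] by (rule differentiableI)

lemma lie_bracket_vf:
  assumes "\<And>k. F k differentiable (at z)" "\<And>k. G k differentiable (at z)"
    and "\<And>k. F' k differentiable (at z)" "\<And>k. G' k differentiable (at z)"
  shows "lie_bracket (vf F G) (vf F' G') z =
    ((\<chi> k. dd (vf F G z) (F' k) z - dd (vf F' G' z) (F k) z),
     (\<chi> k. dd (vf F G z) (G' k) z - dd (vf F' G' z) (G k) z))"
  using frechet_derivative_at[OF has_derivative_vf[OF assms(1,2)], symmetric]
    frechet_derivative_at[OF has_derivative_vf[OF assms(3,4)], symmetric]
  by (simp add: lie_bracket_def vec_eq_iff)

lemma dd_vf:
  assumes "f differentiable (at z)"
  shows "dd (vf F G z) f z = (\<Sum>k\<in>UNIV. F k z * dd (bv k) f z) + (\<Sum>k\<in>UNIV. G k z * dd (fv k) f z)"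
  unfolding dd_expand[OF assms, of "vf F G z"] by (simp add: vf_def)

lemma smooth_vf:
  fixes f :: "'n coords \<Rightarrow> real"
  assumes "\<And>k. smooth_on S (F k)" "\<And>k. smooth_on S (G k)" "smooth_on S f"
  shows "smooth_on S (\<lambda>w. dd (vf F G w) f w)"
proof -
  have "smooth_on S (\<lambda>w. (\<Sum>k\<in>UNIV. F k w * dd (bv k) f w) + (\<Sum>k\<in>UNIV. G k w * dd (fv k) f w))"
    by (intro smooth_intros open_S assms)
  then show ?thesis
    by (subst smooth_on_cong[OF open_S])
       (auto intro: dd_vf smooth_on_differentiable[OF assms(3)])
qed

text \<open>The Hamiltonian vector field of \<open>H\<close>, that is, the geodesic spray.\<close>

definition "xi = vf pu (\<lambda>s w. - dd (bv s) H w)"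

definition "E i = vf (\<lambda>_ _. 0) (\<lambda>k. gl i k)"

lemma dd_xi:
  assumes "f differentiable (at z)"
  shows "dd (xi z) f z = (\<Sum>s\<in>UNIV. pu s z * dd (bv s) f z) - (\<Sum>s\<in>UNIV. dd (bv s) H z * dd (fv s) f z)"
  by (simp add: xi_def dd_vf[OF assms] sum_negf)

lemma dd_E:
  assumes "f differentiable (at z)"
  shows "dd (E i z) f z = (\<Sum>k\<in>UNIV. gl i k z * dd (fv k) f z)"
  by (simp add: E_def dd_vf[OF assms])

lemma dd_gl_sym: "z \<in> S \<Longrightarrow> dd h (gl i j) z = dd h (gl j i) z"
  by (rule dd_cong[OF open_S]) (auto intro: gl_sym)

text \<open>Contraction with p_i turns g^{is} into p^s; \<open>dd_gl_pu\<close> then moves the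
  derivative from the metric to p^s in two of the three terms, base directions having no momentum
  part.\<close>

lemma christoffel_o_eq:
  assumes z: "z \<in> S"
  shows "christoffel_o L j k z = - 1/2 * ((\<Sum>s\<in>UNIV. gl j s z * dd (bv k) (pu s) z)
    + (\<Sum>s\<in>UNIV. gl k s z * dd (bv j) (pu s) z) + (\<Sum>s\<in>UNIV. pu s z * dd (bv s) (gl j k) z))"
proof -
  let ?X = "\<lambda>s. dd (bv k) (gl j s) z + dd (bv j) (gl s k) z - dd (bv s) (gl j k) z"
  have "christoffel_o L j k z = (\<Sum>i\<in>UNIV. \<Sum>s\<in>UNIV. 1/2 * (gu s i z * snd z $ i * ?X s))"
    unfolding christoffel_o_def christoffel_def bpartial_def sum_distrib_left sum_distrib_right
    by (intro sum.cong refl) (simp add: gu_sym[OF z] mult_ac)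
  also have "\<dots> = 1/2 * (\<Sum>s\<in>UNIV. pu s z * ?X s)"
    unfolding gu_p[OF z, symmetric] by (subst sum.swap) (simp add: sum_distrib_left sum_distrib_right)
  also have "(\<Sum>s\<in>UNIV. pu s z * ?X s) = (\<Sum>s\<in>UNIV. pu s z * dd (bv k) (gl j s) z) +
      (\<Sum>s\<in>UNIV. pu s z * dd (bv j) (gl k s) z) - (\<Sum>s\<in>UNIV. pu s z * dd (bv s) (gl j k) z)"
    unfolding dd_gl_sym[OF z, where j = k] by (simp add: distrib_left right_diff_distrib sum.distrib sum_subtractf)
  finally show ?thesis by (simp add: dd_gl_pu[OF z] field_simps)
qed

text \<open>In the contraction with p^k the first and third sums cancel by \<open>dd_gl_pu\<close>,
  and the middle one is 2 \<partial>_j H by Euler's relation for \<partial>_j H. The outcome is the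
  momentum component of \<open>xi\<close>.\<close>

lemma christoffel_oo_eq:
  assumes z: "z \<in> S"
  shows "christoffel_oo L j z = - dd (bv j) H z"
proof -
  have pdp: "(\<Sum>s\<in>UNIV. snd z $ s * dd (bv j) (pu s) z) = 2 * dd (bv j) H z"
  proof -
    have "dd (bv j) (pu s) z = dd (fv s) (dd (bv j) H) z" for s
      unfolding pu_def by (rule dd_commute[OF open_S smooth_H z])
    then show ?thesis
      using euler_bv_H[OF z] dd_vertical[of "dd (bv j) H" z "snd z"] diff_basic[OF z] by simp
  qed
  have a: "(\<Sum>k\<in>UNIV. (\<Sum>s\<in>UNIV. gl k s z * dd (bv j) (pu s) z) * pu k z) = 2 * dd (bv j) H z"
  proof -
    have "(\<Sum>k\<in>UNIV. (\<Sum>s\<in>UNIV. gl k s z * dd (bv j) (pu s) z) * pu k z) =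
        (\<Sum>s\<in>UNIV. (\<Sum>k\<in>UNIV. gl s k z * pu k z) * dd (bv j) (pu s) z)"
      unfolding sum_distrib_right
      by (subst sum.swap) (intro sum.cong refl, simp add: gl_sym[OF z] mult_ac)
    then show ?thesis by (simp add: gl_pu[OF z] pdp)
  qed
  have b: "(\<Sum>k\<in>UNIV. (\<Sum>s\<in>UNIV. pu s z * dd (bv s) (gl j k) z) * pu k z) =
      - (\<Sum>k\<in>UNIV. (\<Sum>s\<in>UNIV. gl j s z * dd (bv k) (pu s) z) * pu k z)"
  proof -
    have "(\<Sum>k\<in>UNIV. (\<Sum>s\<in>UNIV. pu s z * dd (bv s) (gl j k) z) * pu k z) =
        (\<Sum>s\<in>UNIV. pu s z * (\<Sum>k\<in>UNIV. pu k z * dd (bv s) (gl j k) z))"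
      unfolding sum_distrib_right sum_distrib_left
      by (subst sum.swap) (intro sum.cong refl, simp add: mult_ac)
    also have "\<dots> = - (\<Sum>s\<in>UNIV. pu s z * (\<Sum>k\<in>UNIV. gl j k z * dd (bv s) (pu k) z))"
      by (simp add: dd_gl_pu[OF z] sum_negf)
    finally show ?thesis by (simp add: mult.commute)
  qed
  have "christoffel_oo L j z = - 1/2 * ((\<Sum>k\<in>UNIV. (\<Sum>s\<in>UNIV. gl j s z * dd (bv k) (pu s) z) * pu k z)
    + (\<Sum>k\<in>UNIV. (\<Sum>s\<in>UNIV. gl k s z * dd (bv j) (pu s) z) * pu k z)
    + (\<Sum>k\<in>UNIV. (\<Sum>s\<in>UNIV. pu s z * dd (bv s) (gl j k) z) * pu k z))"
    unfolding christoffel_oo_def pup_eq[OF z] sum.distrib[symmetric] sum_distrib_left[of "- 1/2"]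
    by (intro sum.cong refl) (simp only: christoffel_o_eq[OF z] distrib_right mult.assoc)
  then show ?thesis unfolding a b by simp
qed

text \<open>The correction term in \<open>nonlin_conn\<close> is the momentum part of the spray
  acting on g_jk; together with the p^s \<partial>_s term of \<open>christoffel_o_eq\<close> it
  makes up the full derivative along \<open>xi\<close>.\<close>

lemma nonlin_conn_eq:
  assumes z: "z \<in> S"
  shows "N j k z = - 1/2 * ((\<Sum>s\<in>UNIV. gl j s z * dd (bv k) (pu s) z)
    + (\<Sum>s\<in>UNIV. gl k s z * dd (bv j) (pu s) z) + dd (xi z) (gl j k) z)"
  unfolding nonlin_conn_def fpartial_def christoffel_oo_eq[OF z] christoffel_o_eq[OF z]
    dd_xi[OF diff_basic(4)[OF z]]
  by (simp add: sum_negf algebra_simps)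

lemma smooth_N: "smooth_on S (N i j)"
  by (subst smooth_on_cong[OF open_S nonlin_conn_eq])
     (assumption, unfold xi_def, intro smooth_intros smooth_vf open_S smooth_basic)

lemma nonlin_conn_sym: "z \<in> S \<Longrightarrow> N i j z = N j i z"
  by (simp add: nonlin_conn_eq dd_gl_sym[where i = i and j = j])

lemma hframe_vf: "hframe L i = vf (\<lambda>k _. axis i 1 $ k) (N i)"
  by (simp add: hframe_def vf_def fun_eq_iff vec_eq_iff)

lemma sum_axis: "(\<Sum>k\<in>UNIV. axis i 1 $ k * f k) = (f i :: real)" for i :: 'n
  by (simp add: axis_def if_distrib[of "\<lambda>x. x * _"] cong: if_cong)

lemma dd_hframe:
  assumes "f differentiable (at z)"
  shows "dd (hframe L i z) f z = dd (bv i) f z + (\<Sum>k\<in>UNIV. N i k z * dd (fv k) f z)"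
  by (simp only: hframe_vf dd_vf[OF assms] sum_axis)

text \<open>The point is p^j N_ij = - \<partial>_i H. In this contraction the first term cancels the
  spray term, and the middle one is 2 \<partial>_i H because \<partial>_i H has degree two.\<close>

lemma dd_hframe_H:
  assumes z: "z \<in> S"
  shows "dd (hframe L i z) H z = 0"
proof -
  have xip: "dd (xi z) (pu j) z = (\<Sum>s\<in>UNIV. pu s z * dd (bv s) (pu j) z)
      - (\<Sum>s\<in>UNIV. gu j s z * dd (bv s) H z)" for j
    using gu_sym[OF z, of j] by (simp add: dd_xi diff_basic[OF z] gu_eq[OF z, symmetric] mult.commute)
  have "(\<Sum>j\<in>UNIV. pu j z * dd (xi z) (gl i j) z) =
      snd (xi z) $ i - (\<Sum>j\<in>UNIV. gl i j z * dd (xi z) (pu j) z)"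
    by (rule dd_gl_pu[OF z])
  also have "(\<Sum>j\<in>UNIV. gl i j z * dd (xi z) (pu j) z) =
      (\<Sum>j\<in>UNIV. gl i j z * (\<Sum>s\<in>UNIV. pu s z * dd (bv s) (pu j) z)) - dd (bv i) H z"
    unfolding xip by (simp only: right_diff_distrib sum_subtractf lower_raise[OF z])
  finally have 3: "(\<Sum>j\<in>UNIV. pu j z * dd (xi z) (gl i j) z) =
      - (\<Sum>j\<in>UNIV. gl i j z * (\<Sum>s\<in>UNIV. pu s z * dd (bv s) (pu j) z))"
    by (simp add: xi_def vf_def)
  have 1: "(\<Sum>j\<in>UNIV. pu j z * (\<Sum>s\<in>UNIV. gl i s z * dd (bv j) (pu s) z)) =
      (\<Sum>j\<in>UNIV. gl i j z * (\<Sum>s\<in>UNIV. pu s z * dd (bv s) (pu j) z))"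
    unfolding sum_distrib_left by (subst sum.swap) (simp add: mult_ac)
  have 2: "(\<Sum>j\<in>UNIV. pu j z * (\<Sum>s\<in>UNIV. gl j s z * dd (bv i) (pu s) z)) = 2 * dd (bv i) H z"
  proof -
    have "(\<Sum>j\<in>UNIV. pu j z * (\<Sum>s\<in>UNIV. gl j s z * dd (bv i) (pu s) z)) =
        (\<Sum>s\<in>UNIV. (\<Sum>j\<in>UNIV. gl s j z * pu j z) * dd (bv i) (pu s) z)"
      unfolding sum_distrib_right sum_distrib_left
      by (subst sum.swap) (intro sum.cong refl, simp add: gl_sym[OF z] mult_ac)
    also have "\<dots> = (\<Sum>s\<in>UNIV. snd z $ s * dd (fv s) (dd (bv i) H) z)"
      unfolding gl_pu[OF z] unfolding pu_def dd_commute[OF open_S smooth_H z, of "bv i"] ..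
    also have "\<dots> = dd (0, snd z) (dd (bv i) H) z"
      by (rule dd_vertical[symmetric]) (rule diff_basic[OF z])
    finally show ?thesis by (simp add: euler_bv_H[OF z])
  qed
  have "(\<Sum>j\<in>UNIV. N i j z * dd (fv j) H z) = (\<Sum>j\<in>UNIV. pu j z * N i j z)"
    by (simp add: pu_def mult.commute)
  also have "\<dots> = - 1/2 * ((\<Sum>j\<in>UNIV. pu j z * (\<Sum>s\<in>UNIV. gl i s z * dd (bv j) (pu s) z))
      + (\<Sum>j\<in>UNIV. pu j z * (\<Sum>s\<in>UNIV. gl j s z * dd (bv i) (pu s) z))
      + (\<Sum>j\<in>UNIV. pu j z * dd (xi z) (gl i j) z))"
    unfolding nonlin_conn_eq[OF z] sum.distrib[symmetric] distrib_left[symmetric]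
    by (simp only: sum_distrib_left mult.left_commute)
  also have "\<dots> = - dd (bv i) H z" unfolding 1 2 3 by simp
  finally show ?thesis by (simp add: dd_hframe[OF diff_basic(1)[OF z]])
qed

lemma diff_vector_fields:
  assumes z: "z \<in> S"
  shows "xi differentiable (at z)" "E i differentiable (at z)" "hframe L i differentiable (at z)"
  unfolding xi_def E_def hframe_vf
  by (intro differentiable_vf smooth_on_differentiable[OF _ z] smooth_intros open_S smooth_basic smooth_N)+

subsection \<open>Absence of torsion\<close>

text \<open>Up to sign, E_i g_jl is the tensor of third momentum derivatives of \<open>H\<close>
  with its three indices lowered, and third derivatives are symmetric.\<close>

lemma dd_E_gl:
  assumes z: "z \<in> S"
  shows "dd (E i z) (gl j l) z = dd (E j z) (gl i l) z"
proof -
  define T where "T k a = (\<Sum>b\<in>UNIV. dd (fv k) (gu a b) z * gl b l z)" for k a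
  have T: "T k a = T a k" for k a
  proof -
    have "dd (fv k) (gu a b) z = dd (fv a) (gu k b) z" for b
    proof -
      have "dd (fv k) (gu a b) z = dd (fv k) (dd (fv a) (pu b)) z"
        by (rule dd_cong[OF open_S z]) (rule gu_eq)
      also have "\<dots> = dd (fv a) (dd (fv k) (pu b)) z" by (rule dd_commute[OF open_S smooth_pu z])
      also have "\<dots> = dd (fv a) (gu k b) z"
        by (rule dd_cong[OF open_S z]) (rule gu_eq[symmetric])
      finally show ?thesis .
    qed
    then show ?thesis by (simp add: T_def)
  qed
  have *: "dd (E i z) (gl j l) z = - (\<Sum>k\<in>UNIV. \<Sum>a\<in>UNIV. gl i k z * gl j a z * T k a)" for i j
  proof -
    have "dd (fv k) (gl j l) z = - (\<Sum>a\<in>UNIV. gl j a z * T k a)" for k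
      unfolding T_def by (rule dd_gl[OF z])
    then show ?thesis
      by (simp add: dd_E[OF diff_basic(4)[OF z]] sum_distrib_left sum_negf mult.assoc)
  qed
  show ?thesis
    unfolding * by (subst sum.swap) (simp add: mult_ac T)
qed

lemma lie_bracket_E:
  assumes z: "z \<in> S"
  shows "lie_bracket (E i) (E j) z = 0"
  unfolding E_def
  by (subst lie_bracket_vf)
     (auto simp: diff_basic[OF z] E_def[symmetric] vec_eq_iff prod_eq_iff dd_E_gl[OF z, of i])

text \<open>The coordinate field \<open>\<partial>/\<partial>x^i\<close> of the Lagrangian coordinates \<open>(x^i, p^i)\<close>; the
  coordinate fields \<open>\<partial>/\<partial>p^i\<close> are \<open>E i\<close>.\<close>

definition "D i = vf (\<lambda>k _. axis i 1 $ k) (\<lambda>l w. - (\<Sum>s\<in>UNIV. dd (bv i) (pu s) w * gl s l w))"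

lemma dd_D:
  assumes z: "z \<in> S" and f: "f differentiable (at z)"
  shows "dd (D i z) f z = dd (bv i) f z - (\<Sum>s\<in>UNIV. dd (bv i) (pu s) z * dd (E s z) f z)"
proof -
  have "(\<Sum>k\<in>UNIV. (\<Sum>s\<in>UNIV. dd (bv i) (pu s) z * gl s k z) * dd (fv k) f z) =
      (\<Sum>s\<in>UNIV. dd (bv i) (pu s) z * (\<Sum>k\<in>UNIV. gl s k z * dd (fv k) f z))"
    unfolding sum_distrib_left sum_distrib_right by (subst sum.swap) (simp add: mult_ac)
  then show ?thesis
    by (simp add: D_def dd_vf[OF f] sum_axis dd_E[OF f] sum_negf)
qed

lemma diff_D:
  assumes z: "z \<in> S"
  shows "D i differentiable (at z)"
  unfolding D_def
  by (intro differentiable_vf smooth_on_differentiable[OF _ z] smooth_intros open_S smooth_basic)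

text \<open>Both are coordinate fields of (x^i, p^i), but the bracket is computed in components, so
  no Legendre diffeomorphism has to be built. Lowering E_j \<partial>_i p^s = g_jk \<partial>_i
  g^{ks} gives - \<partial>_i g_jl, and \<open>dd_E_gl\<close> completes this to - D_i g_jl.\<close>

lemma lie_bracket_D_E:
  assumes z: "z \<in> S"
  shows "lie_bracket (D i) (E j) z = 0"
proof -
  let ?A = "\<lambda>s. dd (bv i) (pu s)"
  have A: "dd (E j z) (?A s) z = (\<Sum>k\<in>UNIV. gl j k z * dd (bv i) (gu k s) z)" for s
  proof -
    have "dd (fv k) (?A s) z = dd (bv i) (gu k s) z" for k
    proof -
      have "dd (bv i) (gu k s) z = dd (bv i) (dd (fv k) (pu s)) z"
        by (rule dd_cong[OF open_S z]) (rule gu_eq)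
      then show ?thesis by (simp only: dd_commute[OF open_S smooth_pu z, of s "bv i"])
    qed
    then show ?thesis by (simp add: dd_E diff_basic[OF z])
  qed
  have "dd (E j z) (\<lambda>w. \<Sum>s\<in>UNIV. ?A s w * gl s l w) z =
      (\<Sum>s\<in>UNIV. ?A s z * dd (E j z) (gl s l) z + dd (E j z) (?A s) z * gl s l z)" for l
    by (simp add: dd_sum dd_mult diff_basic[OF z])
  also have "(\<Sum>s\<in>UNIV. ?A s z * dd (E j z) (gl s l) z + dd (E j z) (?A s) z * gl s l z) =
     (\<Sum>s\<in>UNIV. ?A s z * dd (E s z) (gl j l) z) - dd (bv i) (gl j l) z" for l
  proof -
    have "(\<Sum>s\<in>UNIV. dd (E j z) (?A s) z * gl s l z) = - dd (bv i) (gl j l) z"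
      unfolding A dd_gl[OF z] sum_distrib_left sum_distrib_right minus_minus
      by (subst sum.swap) (simp add: mult_ac)
    then show ?thesis by (simp add: sum.distrib dd_E_gl[OF z, of j])
  qed
  finally have 1: "dd (E j z) (\<lambda>w. \<Sum>s\<in>UNIV. ?A s w * gl s l w) z = - dd (D i z) (gl j l) z" for l
    by (simp add: dd_D[OF z] diff_basic[OF z])
  have d: "(\<lambda>w. \<Sum>s\<in>UNIV. ?A s w * gl s l w) differentiable (at z)" for l
    by (intro smooth_on_differentiable[OF _ z] smooth_intros open_S smooth_basic)
  have 2: "dd (E j z) (\<lambda>w. - (\<Sum>s\<in>UNIV. ?A s w * gl s l w)) z = dd (D i z) (gl j l) z" for l
    by (simp add: dd_minus[OF d] 1)
  have "lie_bracket (D i) (E j) z = ((\<chi> k. dd (D i z) (\<lambda>_. 0) z - dd (E j z) (\<lambda>_. axis i 1 $ k) z),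
     (\<chi> l. dd (D i z) (gl j l) z - dd (E j z) (\<lambda>w. - (\<Sum>s\<in>UNIV. ?A s w * gl s l w)) z))"
    unfolding D_def E_def
    by (rule lie_bracket_vf) (simp_all add: diff_basic[OF z] d)
  then show ?thesis by (simp add: 2 prod_eq_iff vec_eq_iff)
qed

text \<open>The horizontal projector of the geodesic spray: \<open>\<delta>\<^sub>i = (D\<^sub>i - [\<xi>, E\<^sub>i]) / 2\<close>.\<close>

lemma lie_bracket_xi_E:
  assumes z: "z \<in> S"
  shows "lie_bracket xi (E i) z = D i z - 2 *\<^sub>R hframe L i z"
proof -
  \<comment> \<open>As E_i p^k is the Kronecker symbol, the base part of the bracket is minus the
    i-th unit vector, like that of D_i - 2 \<delta>_i.\<close>
  have 1: "dd (E i z) (pu k) z = axis i 1 $ k" for k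
    unfolding dd_E[OF diff_basic(2)[OF z]] gu_eq[OF z, symmetric] gl_gu[OF z]
    by (simp add: axis_def)
  have "dd (E i z) (\<lambda>w. - dd (bv l) H w) z = - (\<Sum>k\<in>UNIV. gl i k z * dd (bv l) (pu k) z)" for l
    using dd_commute[OF open_S smooth_H z, of _ "bv l"]
    by (simp add: dd_minus diff_basic[OF z] dd_E pu_def)
  moreover have "2 * N i l z = - ((\<Sum>s\<in>UNIV. gl i s z * dd (bv l) (pu s) z)
    + (\<Sum>s\<in>UNIV. dd (bv i) (pu s) z * gl s l z) + dd (xi z) (gl i l) z)" for l
    using gl_sym[OF z, of l] by (simp add: nonlin_conn_eq[OF z] mult.commute field_simps)
  ultimately have 2: "dd (xi z) (gl i l) z - dd (E i z) (\<lambda>w. - dd (bv l) H w) z =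
      - (\<Sum>s\<in>UNIV. dd (bv i) (pu s) z * gl s l z) - 2 * N i l z" for l
    by simp
  have "lie_bracket xi (E i) z = ((\<chi> k. dd (xi z) (\<lambda>_. 0) z - dd (E i z) (pu k) z),
     (\<chi> l. dd (xi z) (gl i l) z - dd (E i z) (\<lambda>w. - dd (bv l) H w) z))"
    unfolding xi_def E_def
    by (rule lie_bracket_vf) (auto simp: diff_basic[OF z] intro!: differentiable_minus)
  then show ?thesis
    by (simp add: 1 2 prod_eq_iff vec_eq_iff D_def hframe_vf vf_def)
qed

abbreviation op :: "('n coords \<Rightarrow> 'n coords) \<Rightarrow> ('n coords \<Rightarrow> real) \<Rightarrow> 'n coords \<Rightarrow> real" where
  "op V f \<equiv> (\<lambda>w. dd (V w) f w)"

lemma smooth_op: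
  assumes "smooth_on S f"
  shows "smooth_on S (op xi f)" "smooth_on S (op (E i) f)" "smooth_on S (op (D i) f)"
  unfolding xi_def E_def D_def
  by (intro smooth_vf assms smooth_intros open_S smooth_basic)+

lemma op_E_commute:
  assumes "smooth_on S f" and z: "z \<in> S"
  shows "op (E i) (op (E j) f) z = op (E j) (op (E i) f) z"
proof -
  have "dd 0 f z = 0"
    using linear_0[OF linear_dd[OF smooth_on_differentiable[OF assms]]] .
  then show ?thesis
    using commutator_eq_lie_bracket[OF open_S assms diff_vector_fields(2)[OF z] diff_vector_fields(2)[OF z], of i j]
    by (simp only: lie_bracket_E[OF z])
qed

lemma op_D_E_commute:
  assumes "smooth_on S f" and z: "z \<in> S"
  shows "op (D i) (op (E j) f) z = op (E j) (op (D i) f) z"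
proof -
  have "dd 0 f z = 0"
    using linear_0[OF linear_dd[OF smooth_on_differentiable[OF assms]]] .
  then show ?thesis
    using commutator_eq_lie_bracket[OF open_S assms diff_D[OF z] diff_vector_fields(2)[OF z], of j i]
    by (simp only: lie_bracket_D_E[OF z])
qed

lemma op_hframe:
  assumes "smooth_on S f" and z: "z \<in> S"
  shows "op (hframe L i) f z = 1/2 * (op (D i) f z - op xi (op (E i) f) z + op (E i) (op xi f) z)"
proof -
  have l: "linear (\<lambda>h. dd h f z)" by (rule linear_dd[OF smooth_on_differentiable[OF assms]])
  have "op xi (op (E i) f) z - op (E i) (op xi f) z = dd (D i z - 2 *\<^sub>R hframe L i z) f z"
    using commutator_eq_lie_bracket[OF open_S assms diff_vector_fields(1)[OF z] diff_vector_fields(2)[OF z], of i]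
    by (simp only: lie_bracket_xi_E[OF z])
  also have "\<dots> = op (D i) f z - 2 * op (hframe L i) f z"
    by (simp only: linear_diff[OF l] linear_cmul[OF l] real_scaleR_def)
  finally show ?thesis by simp
qed

text \<open>Up to the symmetric terms, this is the Jacobi identity for \<open>\<xi>\<close>, \<open>E i\<close>, \<open>E j\<close>.\<close>

lemma torsion_free:
  assumes z: "z \<in> S"
  shows "dd (E j z) (N i l) z - dd (hframe L i z) (gl j l) z =
    dd (E i z) (N j l) z - dd (hframe L j z) (gl i l) z"
proof -
  \<comment> \<open>A field applied to the coordinate p_l returns its l-th momentum component: E_i
    p_l = g_il and \<delta>_i p_l = N_il. Hence all terms of the claim are operator words applied to
    p_l.\<close>
  let ?P = "\<lambda>w::'n coords. snd w $ l"
  have sP: "smooth_on S ?P" by (rule smooth_on_bounded_linear[OF bounded_linear_snd_nth])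
  have E: "op (E i) ?P = gl i l" for i by (simp add: dd_momentum E_def vf_def)
  have Nop: "op (hframe L i) ?P = N i l" for i by (simp add: dd_momentum hframe_def)
  have EN: "dd (E j z) (N i l) z = 1/2 * (op (E j) (op (D i) ?P) z
      - op (E j) (op xi (op (E i) ?P)) z + op (E j) (op (E i) (op xi ?P)) z)" for i j
  proof -
    note d = smooth_on_differentiable[OF smooth_op(1) z] smooth_on_differentiable[OF smooth_op(2) z]
       smooth_on_differentiable[OF smooth_op(3) z]
    have "dd (E j z) (N i l) z = dd (E j z)
        (\<lambda>w. 1/2 * (op (D i) ?P w - op xi (op (E i) ?P) w + op (E i) (op xi ?P) w)) z"
      unfolding Nop[symmetric] by (rule dd_cong[OF open_S z]) (rule op_hframe[OF sP])
    also have "\<dots> = 1/2 * (op (E j) (op (D i) ?P) z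
      - op (E j) (op xi (op (E i) ?P)) z + op (E j) (op (E i) (op xi ?P)) z)"
      by (subst dd_cmult dd_add dd_diff;
          (intro differentiable_add differentiable_diff d smooth_op sP)?)+ (rule refl)
    finally show ?thesis .
  qed
  have hg: "dd (hframe L i z) (gl j l) z = 1/2 * (op (E j) (op (D i) ?P) z
      - op xi (op (E i) (op (E j) ?P)) z + op (E i) (op xi (op (E j) ?P)) z)" for i j
    unfolding E[of j, symmetric] op_hframe[OF smooth_op(2)[OF sP] z]
    unfolding op_D_E_commute[OF sP z] ..
  \<comment> \<open>The D-terms have cancelled, and each side is half of (E_j E_i \<xi> - E_j \<xi>
    E_i - E_i \<xi> E_j + \<xi> E_i E_j) p_l or its exchange of i and j; the two agree since the
    E-fields commute.\<close>
  have "op xi (op (E i) (op (E j) ?P)) z = op xi (op (E j) (op (E i) ?P)) z"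
    by (rule dd_cong[OF open_S z]) (rule op_E_commute[OF sP])
  moreover have "op (E j) (op (E i) (op xi ?P)) z = op (E i) (op (E j) (op xi ?P)) z"
    by (rule op_E_commute[OF smooth_op(1)[OF sP] z])
  ultimately show ?thesis unfolding EN hg by (simp add: field_simps)
qed

subsection \<open>Homogeneity of the connection and its curvature\<close>

lemma scales_mult: "scales r c f \<Longrightarrow> scales r d g \<Longrightarrow> scales r (c * d) (\<lambda>w. f w * g w)"
  by (simp add: scales_def mult_ac)

lemma scales_add: "scales r c f \<Longrightarrow> scales r c g \<Longrightarrow> scales r c (\<lambda>w. f w + g w)"
  by (simp add: scales_def distrib_left)

lemma scales_diff: "scales r c f \<Longrightarrow> scales r c g \<Longrightarrow> scales r c (\<lambda>w. f w - g w)"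
  by (simp add: scales_def right_diff_distrib)

lemma scales_sum: "(\<And>i. scales r c (f i)) \<Longrightarrow> scales r c (\<lambda>w. \<Sum>i\<in>I. f i w)"
  by (simp add: scales_def sum_distrib_left)

lemma scales_cmult: "scales r c f \<Longrightarrow> scales r c (\<lambda>w. a * f w)"
  by (simp add: scales_def)

lemma scales_N:
  assumes r: "r > 0"
  shows "scales r r (N i j)"
proof -
  let ?f = "\<lambda>w. - 1/2 * ((\<Sum>s\<in>UNIV. gl i s w * dd (bv j) (pu s) w)
    + (\<Sum>s\<in>UNIV. gl j s w * dd (bv i) (pu s) w) + ((\<Sum>s\<in>UNIV. pu s w * dd (bv s) (gl i j) w)
    - (\<Sum>s\<in>UNIV. dd (bv s) H w * dd (fv s) (gl i j) w)))"
  have 1: "scales r r (\<lambda>w. gl a s w * dd (bv b) (pu s) w)" for a b s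
    using scales_mult[OF scales_gl[OF r] scales_bv[OF smooth_pu scales_pu[OF r] r]] by simp
  have 2: "scales r r (\<lambda>w. pu s w * dd (bv s) (gl i j) w)" for s
    using scales_mult[OF scales_pu[OF r] scales_bv[OF smooth_gl scales_gl[OF r] r]] by simp
  have 3: "scales r r (\<lambda>w. dd (bv s) H w * dd (fv s) (gl i j) w)" for s
    using scales_mult[OF scales_bv[OF smooth_H scales_H[OF r] r] scales_fv[OF smooth_gl scales_gl[OF r] r]] r
    by (simp add: power2_eq_square)
  have "scales r r ?f"
    by (intro scales_cmult scales_add scales_diff scales_sum 1 2 3)
  moreover have "N i j z = ?f z" if "z \<in> S" for z
    by (simp only: nonlin_conn_eq[OF that] dd_xi[OF diff_basic(4)[OF that]])
  ultimately show ?thesis using dil_in_S[OF r] by (simp add: scales_def)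
qed

lemma euler_N: "z \<in> S \<Longrightarrow> dd (0, snd z) (N i j) z = N i j z"
  using euler[of "N i j" 1] scales_N smooth_N by simp

text \<open>As \<open>N\<close> has degree one, dilations carry \<delta>_i to itself, so
  differentiating \<open>N\<close> along it preserves the degree.\<close>

lemma scales_curv:
  assumes r: "r > 0"
  shows "scales r r (curv L k i j)"
proof -
  have "scales r r (\<lambda>w. dd (hframe L i w) (N j k) w)" for i j
    unfolding scales_def
  proof
    fix z assume z: "z \<in> S"
    have "hframe L i (dil r z) = dil r (hframe L i z)"
      using scales_N[OF r] z by (simp add: hframe_def dil_def scales_def vec_eq_iff)
    then show "dd (hframe L i (dil r z)) (N j k) (dil r z) = r * dd (hframe L i z) (N j k) z"
      by (simp add: dd_dil[OF smooth_N scales_N[OF r] r z])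
  qed
  then show ?thesis unfolding curv_def[abs_def] by (intro scales_diff)
qed

end

section \<open>The Nijenhuis tensor at a point\<close>

text \<open>The Nijenhuis tensor at \<open>z\<close> involves only first derivatives of
  \<open>J\<close> at \<open>z\<close>, so each w -> J w u is asked to be differentiable at that
  point.\<close>

locale almost_complex_at =
  fixes J :: "'a::euclidean_space \<Rightarrow> 'a \<Rightarrow> 'a" and S :: "'a set" and z :: 'a
  assumes open_dom: "open S" and z_in: "z \<in> S"
    and lin: "\<And>w. w \<in> S \<Longrightarrow> linear (J w)"
    and square: "\<And>w u. w \<in> S \<Longrightarrow> J w (J w u) = - u"
    and diff: "\<And>u. (\<lambda>w. J w u) differentiable (at z)"
begin

definition J' :: "'a \<Rightarrow> 'a \<Rightarrow> 'a" where "J' h u = dd h (\<lambda>w. J w u) z"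

text \<open>The Nijenhuis tensor as a bilinear form in the values of the fields: what remains of the
  four brackets after the derivatives of the fields drop out.\<close>

definition T :: "'a \<Rightarrow> 'a \<Rightarrow> 'a" where
  "T x y = J' (J z x) y - J' (J z y) x + J z (J' y x) - J z (J' x y)"

lemmas lin_z = lin[OF z_in]
lemmas J_simps = linear_add[OF lin_z] linear_diff[OF lin_z] linear_neg[OF lin_z]
  linear_cmul[OF lin_z] linear_0[OF lin_z] square[OF z_in]

lemma J_expand:
  assumes "w \<in> S"
  shows "(\<Sum>b\<in>Basis. (u \<bullet> b) *\<^sub>R J w b) = J w u"
proof -
  have "J w (\<Sum>b\<in>Basis. (u \<bullet> b) *\<^sub>R b) = (\<Sum>b\<in>Basis. (u \<bullet> b) *\<^sub>R J w b)"
    by (simp only: linear_sum[OF lin[OF assms]] linear_cmul[OF lin[OF assms]])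
  then show ?thesis by (simp add: euclidean_representation)
qed

lemma has_derivative_J:
  assumes X: "X differentiable (at z)"
  shows "((\<lambda>w. J w (X w)) has_derivative (\<lambda>h. J' h (X z) + J z (dd h X z))) (at z)"
proof -
  \<comment> \<open>In a basis expansion of X w only the columns w -> J w b of \<open>J\<close> are
    differentiated.\<close>
  have 1: "((\<lambda>w. \<Sum>b\<in>Basis. (X w \<bullet> b) *\<^sub>R J w b) has_derivative
     (\<lambda>h. \<Sum>b\<in>Basis. (X z \<bullet> b) *\<^sub>R dd h (\<lambda>w. J w b) z + (dd h X z \<bullet> b) *\<^sub>R J z b)) (at z)"
    by (intro has_derivative_sum has_derivative_scaleR has_derivative_inner_left
        has_derivative_dd X diff)
  have 2: "((\<lambda>w. \<Sum>b\<in>Basis. (X z \<bullet> b) *\<^sub>R J w b) has_derivative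
       (\<lambda>h. \<Sum>b\<in>Basis. (X z \<bullet> b) *\<^sub>R dd h (\<lambda>w. J w b) z)) (at z)"
    by (intro has_derivative_sum has_derivative_scaleR_right has_derivative_dd diff)
  have "J' h (X z) = (\<Sum>b\<in>Basis. (X z \<bullet> b) *\<^sub>R dd h (\<lambda>w. J w b) z)" for h
    unfolding J'_def
    by (rule dd_eqI, rule has_derivative_transform_within_open[OF 2 open_dom z_in]) (rule J_expand)
  then have "(\<lambda>h. \<Sum>b\<in>Basis. (X z \<bullet> b) *\<^sub>R dd h (\<lambda>w. J w b) z + (dd h X z \<bullet> b) *\<^sub>R J z b) =
      (\<lambda>h. J' h (X z) + J z (dd h X z))"
    by (simp add: sum.distrib J_expand[OF z_in])
  moreover have "((\<lambda>w. J w (X w)) has_derivative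
     (\<lambda>h. \<Sum>b\<in>Basis. (X z \<bullet> b) *\<^sub>R dd h (\<lambda>w. J w b) z + (dd h X z \<bullet> b) *\<^sub>R J z b)) (at z)"
    by (rule has_derivative_transform_within_open[OF 1 open_dom z_in]) (rule J_expand)
  ultimately show ?thesis by (simp only:)
qed

lemma J'_linear_left: "linear (\<lambda>h. J' h u)"
  unfolding J'_def by (rule linear_dd[OF diff])

lemma J'_linear_right: "linear (J' h)"
proof (rule linearI)
  fix x y :: 'a and c :: real
  have "J' h (x + y) = dd h (\<lambda>w. J w x + J w y) z" unfolding J'_def
    by (rule dd_cong[OF open_dom z_in]) (rule linear_add[OF lin])
  then show "J' h (x + y) = J' h x + J' h y" by (simp add: dd_add diff J'_def)
  have "J' h (c *\<^sub>R x) = dd h (\<lambda>w. c *\<^sub>R J w x) z" unfolding J'_def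
    by (rule dd_cong[OF open_dom z_in]) (rule linear_cmul[OF lin])
  also have "\<dots> = c *\<^sub>R dd h (\<lambda>w. J w x) z"
    by (rule dd_eqI) (intro has_derivative_scaleR_right has_derivative_dd diff)
  finally show "J' h (c *\<^sub>R x) = c *\<^sub>R J' h x" by (simp add: J'_def)
qed

lemmas J'_simps = linear_add[OF J'_linear_left] linear_diff[OF J'_linear_left]
  linear_neg[OF J'_linear_left] linear_cmul[OF J'_linear_left] linear_0[OF J'_linear_left]
  linear_add[OF J'_linear_right] linear_diff[OF J'_linear_right]
  linear_neg[OF J'_linear_right] linear_cmul[OF J'_linear_right] linear_0[OF J'_linear_right]

text \<open>Differentiate J^2 = -1: a derivative of \<open>J\<close> anticommutes with
  \<open>J\<close>.\<close>

lemma J'_J: "J' h (J z u) = - J z (J' h u)"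
proof -
  have "dd h (\<lambda>w. J w (J w u)) z = J' h (J z u) + J z (J' h u)"
    using dd_eqI[OF has_derivative_J[OF diff]] by (simp add: J'_def)
  moreover have "dd h (\<lambda>w. J w (J w u)) z = dd h (\<lambda>w. - u) z"
    by (rule dd_cong[OF open_dom z_in]) (rule square)
  ultimately show ?thesis by (simp add: eq_neg_iff_add_eq_0)
qed

text \<open>The eight terms containing a derivative of \<open>X\<close> or \<open>Y\<close> cancel
  in pairs, those along \<open>X z\<close> and \<open>Y z\<close> by J^2 = -1.\<close>

lemma nijenhuis_eq_T:
  assumes X: "X differentiable (at z)" and Y: "Y differentiable (at z)"
  shows "nijenhuis J X Y z = T (X z) (Y z)"
  by (simp add: nijenhuis_def lie_bracket_def dd_eqI[OF has_derivative_J[OF X]]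
      dd_eqI[OF has_derivative_J[OF Y]] T_def J_simps)

lemma T_antisym: "T x y = - T y x"
  by (simp add: T_def)

lemma T_J: "T (J z x) y = - J z (T x y)"
  by (simp add: T_def J_simps J'_simps J'_J)

lemma linear_T: "linear (\<lambda>x. T x y)"
  by (rule linearI) (simp_all add: T_def J_simps J'_simps algebra_simps)

text \<open>In the first slot, vanishing spreads from \<open>B\<close> to its image under
  \<open>J z\<close> by \<open>T_J\<close> and then to everything by linearity; antisymmetry repeats
  this in the second slot.\<close>

lemma T_eq_0_if_span:
  assumes B: "span (B \<union> J z ` B) = UNIV" and 0: "\<And>x y. x \<in> B \<Longrightarrow> y \<in> B \<Longrightarrow> T x y = 0"
  shows "T x y = 0"
proof -
  have ext: "T x y = 0" if "\<And>b. b \<in> B \<Longrightarrow> T b y = 0" for x y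
  proof -
    have "T b y = 0" if "b \<in> B \<union> J z ` B" for b
      using that \<open>\<And>b. b \<in> B \<Longrightarrow> T b y = 0\<close> by (auto simp: T_J J_simps)
    then show ?thesis
      using linear_eq_0_on_span[OF linear_T, of "B \<union> J z ` B" y x] B by blast
  qed
  have "T x b = 0" if "b \<in> B" for x b using ext 0 that by blast
  then show ?thesis using ext[of y x] T_antisym by (metis neg_equal_0_iff_equal)
qed

end

section \<open>The almost complex structure in one chart\<close>

lemma lie_bracket_cong:
  assumes "open S" "z \<in> S" "\<And>w. w \<in> S \<Longrightarrow> X w = X' w" "\<And>w. w \<in> S \<Longrightarrow> Y w = Y' w"
  shows "lie_bracket X Y z = lie_bracket X' Y' z"
  using dd_cong[OF assms(1,2), of X X'] dd_cong[OF assms(1,2), of Y Y'] assms(2-)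
  by (simp add: lie_bracket_def)

locale cartan_acs = cartan_chart U L
  for U :: "(real ^ 'n::finite) set" and L :: "'n coords \<Rightarrow> real" +
  fixes v :: "real \<Rightarrow> real" and \<alpha> \<beta> :: real and J :: "'n coords \<Rightarrow> 'n coords \<Rightarrow> 'n coords"
  assumes pos: "\<alpha> > 0" "\<beta> > 0"
    and diff_v: "\<And>t. t > 0 \<Longrightarrow> v differentiable (at t)"
    and pos': "\<And>z. z \<in> S \<Longrightarrow> \<alpha> + 2 * H z * v (H z) > 0"
    and J_linear: "\<And>z. z \<in> S \<Longrightarrow> linear (J z)"
    and J_h: "\<And>z i. z \<in> S \<Longrightarrow>
      J z (hframe L i z) = (\<Sum>k\<in>UNIV. Glow v \<alpha> \<beta> L z $ i $ k *\<^sub>R vframe k)"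
    and J_v: "\<And>z i. z \<in> S \<Longrightarrow>
      J z (vframe i) = - (\<Sum>k\<in>UNIV. Gup v \<alpha> \<beta> L z $ i $ k *\<^sub>R hframe L k z)"
begin

section \<open>The inverse of G and the square of J\<close>

abbreviation G :: "'n \<Rightarrow> 'n \<Rightarrow> 'n coords \<Rightarrow> real" where "G i j z \<equiv> Glow v \<alpha> \<beta> L z $ i $ j"

lemma G_eq: "G i j z = 1 / \<beta> * gl i j z + v (H z) / (\<alpha> * \<beta>) * snd z $ i * snd z $ j"
  by (simp add: Glow_def H_def)

lemma G_sym: "z \<in> S \<Longrightarrow> G i j z = G j i z"
  using gl_sym[of z i j] by (simp add: G_eq)

text \<open>Sherman-Morrison formula for the rank-one perturbation g + (v/\<alpha>) p p, scaled by
  1/\<beta>. Since p_i p^i = 2 H, the denominator is \<alpha> + 2 H v, positive by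
  \<open>pos'\<close>.\<close>

definition Ginv :: "'n coords \<Rightarrow> real ^ 'n ^ 'n" where
  "Ginv z = (\<chi> i j. \<beta> * (gu i j z - v (H z) / (\<alpha> + 2 * H z * v (H z)) * pu i z * pu j z))"

lemma G_Ginv:
  assumes z: "z \<in> S"
  shows "Glow v \<alpha> \<beta> L z ** Ginv z = mat 1"
proof -
  define w u where "w = v (H z) / \<alpha>" and "u = v (H z) / (\<alpha> + 2 * H z * v (H z))"
  \<comment> \<open>The total coefficient of the rank-one terms p_i p^j in the product;
    \<open>u\<close> is the solution of this equation.\<close>
  have wu: "w - u - 2 * H z * w * u = 0"
    using pos pos'[OF z] by (simp add: w_def u_def field_simps)
  have "(\<Sum>k\<in>UNIV. G i k z * Ginv z $ k $ j) = (if i = j then 1 else 0)" for i j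
  proof -
    have "G i k z * Ginv z $ k $ j = gl i k z * gu k j z + (w * snd z $ i) * (gu j k z * snd z $ k)
        - (u * pu j z) * (gl i k z * pu k z) - (w * u * snd z $ i * pu j z) * (snd z $ k * pu k z)" for k
    proof -
      have "G i k z = 1 / \<beta> * (gl i k z + w * snd z $ i * snd z $ k)"
        using pos by (simp add: G_eq w_def distrib_left)
      moreover have "Ginv z $ k $ j = \<beta> * (gu j k z - u * pu k z * pu j z) \<and> gu j k z = gu k j z"
        using gu_sym[OF z, of k j] by (simp add: Ginv_def u_def)
      ultimately have "G i k z * Ginv z $ k $ j = (gl i k z + w * snd z $ i * snd z $ k) *
          (gu j k z - u * pu k z * pu j z) \<and> gu j k z = gu k j z"
        using pos by simp
      then show ?thesis by (simp add: algebra_simps)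
    qed
    then have "(\<Sum>k\<in>UNIV. G i k z * Ginv z $ k $ j) = (if i = j then 1 else 0) + (w * snd z $ i) * pu j z
        - (u * pu j z) * snd z $ i - (w * u * snd z $ i * pu j z) * (2 * H z)"
      by (simp only: sum.distrib sum_subtractf sum_distrib_left[symmetric]
          gl_gu[OF z] gu_p[OF z] gl_pu[OF z] p_pu[OF z])
    also have "\<dots> = (if i = j then 1 else 0) + (w - u - 2 * H z * w * u) * snd z $ i * pu j z"
      by (simp add: algebra_simps)
    finally show ?thesis by (simp add: wu)
  qed
  then show ?thesis by (simp add: matrix_matrix_mult_def mat_def vec_eq_iff)
qed

lemma Gup_eq:
  assumes z: "z \<in> S"
  shows "Gup v \<alpha> \<beta> L z = Ginv z"
proof -
  have det: "det (Glow v \<alpha> \<beta> L z) \<noteq> 0"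
    using G_Ginv[OF z] by (metis det_I det_mul mult_zero_left zero_neq_one)
  have "matrix_inv (Glow v \<alpha> \<beta> L z) = matrix_inv (Glow v \<alpha> \<beta> L z) ** (Glow v \<alpha> \<beta> L z ** Ginv z)"
    by (simp add: G_Ginv[OF z])
  then show ?thesis
    by (simp add: Gup_def matrix_mul_assoc matrix_inv_mult[OF det])
qed

lemma diff_vH:
  assumes z: "z \<in> S"
  shows "(\<lambda>w. v (H w)) differentiable (at z)"
  using differentiable_chain_at[OF diff_basic(1)[OF z] diff_v[OF H_pos[OF z]]]
  by (simp add: comp_def)

lemma diff_momentum: "(\<lambda>w::'n coords. snd w $ i) differentiable (at z)"
  by (rule bounded_linear_imp_differentiable[OF bounded_linear_snd_nth])

lemma diff_G: "z \<in> S \<Longrightarrow> G i j differentiable (at z)"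
  unfolding G_eq using pos
  by (intro differentiable_add differentiable_mult differentiable_divide differentiable_const
      diff_basic diff_vH diff_momentum) auto

lemma diff_Ginv: "z \<in> S \<Longrightarrow> (\<lambda>w. Ginv w $ i $ j) differentiable (at z)"
  unfolding Ginv_def vec_lambda_beta using pos'[of z]
  by (intro differentiable_add differentiable_diff differentiable_mult differentiable_divide
      differentiable_const diff_basic diff_vH) auto

lemma coords_expand:
  "u = (\<Sum>i\<in>UNIV. fst u $ i *\<^sub>R hframe L i z)
     + (\<Sum>k\<in>UNIV. (snd u $ k - (\<Sum>i\<in>UNIV. fst u $ i * N i k z)) *\<^sub>R fv k)"
  by (simp add: prod_eq_iff fst_sum snd_sum vec_eq_iff hframe_def axis_def
      if_distrib[of "\<lambda>x. _ * x"] cong: if_cong)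

text \<open>Linearity and the values on the frame determine \<open>J\<close>. With the coefficients
  explicit, its differentiability in the base point can be read off.\<close>

lemma J_eq:
  assumes z: "z \<in> S"
  shows "J z u = (\<Sum>i\<in>UNIV. fst u $ i *\<^sub>R (\<Sum>k\<in>UNIV. G i k z *\<^sub>R fv k))
     + (\<Sum>k\<in>UNIV. (snd u $ k - (\<Sum>i\<in>UNIV. fst u $ i * N i k z)) *\<^sub>R
          (- (\<Sum>l\<in>UNIV. Ginv z $ k $ l *\<^sub>R hframe L l z)))"
  using J_h[OF z] J_v[OF z] unfolding vframe_def Gup_eq[OF z]
  by (subst coords_expand[of u z])
     (simp only: linear_add[OF J_linear[OF z]] linear_sum[OF J_linear[OF z]] linear_cmul[OF J_linear[OF z]])

lemma sum_delta_scaleR: "(\<Sum>l\<in>UNIV. (if i = l then 1 else 0) *\<^sub>R f l) = f i"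
  for i :: 'n and f :: "'n \<Rightarrow> 'n coords"
  by (simp add: if_distrib[of "\<lambda>x. x *\<^sub>R _"] cong: if_cong)

lemma sum_matrix_scaleR:
  fixes A B :: "real ^ 'n ^ 'n" and f :: "'n \<Rightarrow> 'n coords"
  assumes "A ** B = mat 1"
  shows "(\<Sum>k\<in>UNIV. A $ i $ k *\<^sub>R (\<Sum>l\<in>UNIV. B $ k $ l *\<^sub>R f l)) = f i"
proof -
  have "(\<Sum>k\<in>UNIV. A $ i $ k * B $ k $ l) = (if i = l then 1 else 0)" for l
    using assms by (simp add: matrix_matrix_mult_def mat_def vec_eq_iff)
  moreover have "(\<Sum>k\<in>UNIV. A $ i $ k *\<^sub>R (\<Sum>l\<in>UNIV. B $ k $ l *\<^sub>R f l)) =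
      (\<Sum>l\<in>UNIV. (\<Sum>k\<in>UNIV. A $ i $ k * B $ k $ l) *\<^sub>R f l)"
    unfolding scaleR_sum_right scaleR_sum_left scaleR_scaleR by (rule sum.swap)
  ultimately show ?thesis by (simp only: sum_delta_scaleR)
qed

lemma J_square:
  assumes z: "z \<in> S"
  shows "J z (J z u) = - u"
proof -
  note l = J_linear[OF z]
  have Ginv_G: "Ginv z ** Glow v \<alpha> \<beta> L z = mat 1"
    using G_Ginv[OF z] matrix_left_right_inverse by blast
  have h: "J z (J z (hframe L i z)) = - hframe L i z" for i
    by (simp only: J_h[OF z] J_v[OF z] linear_sum[OF l] linear_cmul[OF l] Gup_eq[OF z]
        scaleR_minus_right sum_negf sum_matrix_scaleR[OF G_Ginv[OF z]])
  have v: "J z (J z (fv i)) = - fv i" for i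
    by (simp only: J_h[OF z] J_v[OF z] linear_sum[OF l] linear_cmul[OF l] linear_neg[OF l] Gup_eq[OF z]
        sum_matrix_scaleR[OF Ginv_G] vframe_def[symmetric])
  have l2: "linear (\<lambda>u. J z (J z u))"
    using linear_compose[OF l l] by (simp add: comp_def)
  have "J z (J z u) = (\<Sum>i\<in>UNIV. fst u $ i *\<^sub>R - hframe L i z)
     + (\<Sum>k\<in>UNIV. (snd u $ k - (\<Sum>i\<in>UNIV. fst u $ i * N i k z)) *\<^sub>R - fv k)"
    by (subst coords_expand[of u z])
       (simp only: linear_add[OF l2] linear_sum[OF l2] linear_cmul[OF l2] h v)
  also have "\<dots> = - u"
    by (subst (3) coords_expand[of u z]) (simp only: scaleR_minus_right sum_negf minus_add_distrib)
  finally show ?thesis .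
qed

lemma diff_J:
  assumes z: "z \<in> S"
  shows "(\<lambda>w. J w u) differentiable (at z)"
  by (subst differentiable_cong_open[OF open_S z J_eq], assumption)
     (intro differentiable_add differentiable_sum differentiable_scaleR differentiable_const
       differentiable_minus differentiable_diff differentiable_mult diff_G diff_Ginv ballI
       smooth_on_differentiable[OF smooth_N] diff_vector_fields z finite)

lemma almost_complex_at: "z \<in> S \<Longrightarrow> almost_complex_at J S z"
  by (intro almost_complex_at.intro open_S J_linear J_square diff_J)

definition "VG i = vf (\<lambda>_ _. 0) (\<lambda>k. G i k)"

text \<open>The field G_ik \<partial>^k, which is J \<delta>_i on \<open>S\<close>, splits into
  E_i/\<beta> and a multiple of the Liouville field p_k \<partial>^k, on which Euler's relations
  act.\<close>

lemma dd_VG: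
  assumes z: "z \<in> S" and f: "f differentiable (at z)"
  shows "dd (VG i z) f z = 1 / \<beta> * dd (E i z) f z + v (H z) / (\<alpha> * \<beta>) * snd z $ i * dd (0, snd z) f z"
proof -
  have "VG i z = (1 / \<beta>) *\<^sub>R E i z + (v (H z) / (\<alpha> * \<beta>) * snd z $ i) *\<^sub>R (0, snd z)"
    by (simp add: VG_def E_def vf_def prod_eq_iff vec_eq_iff G_eq)
  then show ?thesis
    by (simp only: linear_add[OF linear_dd[OF f]] linear_cmul[OF linear_dd[OF f]] real_scaleR_def)
qed

text \<open>\<open>d\<close> is the derivative of \<open>v\<close> at \<open>H z\<close>. Its value
  may stay open, as its terms drop out later: along J \<delta>_i they are symmetric in the indices,
  and along \<delta>_i they vanish with \<delta>_i H.\<close>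

lemma dd_G:
  assumes z: "z \<in> S"
  shows "\<exists>d. \<forall>h j l. dd h (G j l) z = 1 / \<beta> * dd h (gl j l) z
    + 1 / (\<alpha> * \<beta>) * (d * dd h H z * snd z $ j * snd z $ l
       + v (H z) * (snd h $ j * snd z $ l + snd z $ j * snd h $ l))"
proof -
  obtain d where d: "(v has_real_derivative d) (at (H z))"
    using diff_v[OF H_pos[OF z]] by (auto simp: real_differentiable_def)
  have vH: "dd h (\<lambda>w. v (H w)) z = d * dd h H z" for h
    by (rule dd_eqI, rule has_derivative_compose[OF has_derivative_dd[OF diff_basic(1)[OF z]]
          d[unfolded has_field_derivative_def]])
  have "dd h (G j l) z = 1 / \<beta> * dd h (gl j l) z
    + 1 / (\<alpha> * \<beta>) * (d * dd h H z * snd z $ j * snd z $ l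
       + v (H z) * (snd h $ j * snd z $ l + snd z $ j * snd h $ l))" for h j l
  proof -
    have G: "G j l = (\<lambda>w. 1 / \<beta> * gl j l w + 1 / (\<alpha> * \<beta>) * (v (H w) * (snd w $ j * snd w $ l)))"
      by (simp add: G_eq fun_eq_iff)
    have eq: "dd h (\<lambda>w. a * gl j l w + b * (v (H w) * (snd w $ j * snd w $ l))) z =
        a * dd h (gl j l) z + b * (v (H z) * (snd z $ j * snd h $ l + snd h $ j * snd z $ l)
          + d * dd h H z * (snd z $ j * snd z $ l))" for a b
      by (simp only: dd_add dd_cmult dd_mult dd_momentum vH diff_basic[OF z] diff_vH[OF z] diff_momentum
          differentiable_mult differentiable_const)
    show ?thesis unfolding G eq by (simp add: ac_simps)
  qed
  then show ?thesis by blast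
qed

lemma nijenhuis_hframe:
  assumes z: "z \<in> S"
  shows "nijenhuis J (hframe L i) (hframe L j) z =
    (0, \<chi> l. v (H z) / (\<alpha> * \<beta>\<^sup>2) * (gl i l z * snd z $ j - gl j l z * snd z $ i) - curv L l i j z)"
proof -
  obtain d where d: "\<And>h j l. dd h (G j l) z = 1 / \<beta> * dd h (gl j l) z
    + 1 / (\<alpha> * \<beta>) * (d * dd h H z * snd z $ j * snd z $ l
       + v (H z) * (snd h $ j * snd z $ l + snd z $ j * snd h $ l))"
    using dd_G[OF z] by blast
  have Jh: "J w (hframe L i w) = VG i w" if "w \<in> S" for i w
    using J_h[OF that]
    by (simp add: VG_def vf_def vframe_def prod_eq_iff fst_sum snd_sum vec_eq_iff axis_def
        if_distrib[of "\<lambda>x. _ * x"] cong: if_cong)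
  note df = diff_basic[OF z] diff_G[OF z] smooth_on_differentiable[OF smooth_N z]
  have b1: "lie_bracket (\<lambda>w. J w (hframe L i w)) (\<lambda>w. J w (hframe L j w)) z =
     (0, \<chi> l. dd (VG i z) (G j l) z - dd (VG j z) (G i l) z)"
    by (rule trans[OF lie_bracket_cong[OF open_S z, where X' = "VG i" and Y' = "VG j"]])
       (simp_all add: Jh,
        simp add: VG_def lie_bracket_vf df vec_eq_iff)
  have b2: "lie_bracket (\<lambda>w. J w (hframe L i w)) (hframe L j) z =
     (0, \<chi> l. dd (VG i z) (N j l) z - dd (hframe L j z) (G i l) z)"
    by (rule trans[OF lie_bracket_cong[OF open_S z, where X' = "VG i" and Y' = "hframe L j"]])
       (simp_all add: Jh,
        simp add: VG_def hframe_vf lie_bracket_vf df vec_eq_iff)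
  have b3: "lie_bracket (hframe L i) (\<lambda>w. J w (hframe L j w)) z =
     (0, \<chi> l. dd (hframe L i z) (G j l) z - dd (VG j z) (N i l) z)"
    by (rule trans[OF lie_bracket_cong[OF open_S z, where X' = "hframe L i" and Y' = "VG j"]])
       (simp_all add: Jh,
        simp add: VG_def hframe_vf lie_bracket_vf df vec_eq_iff)
  have b4: "lie_bracket (hframe L i) (hframe L j) z = (0, \<chi> l. curv L l i j z)"
    by (simp add: hframe_vf lie_bracket_vf df vec_eq_iff curv_def)
  have VGH: "dd (VG i z) H z = (1 / \<beta> + v (H z) / (\<alpha> * \<beta>) * (2 * H z)) * snd z $ i" for i
    by (simp add: dd_VG[OF z] df dd_E euler_H[OF z] gl_pu[OF z, unfolded pu_def] algebra_simps)
  have sVG: "snd (VG i z) $ j = G i j z" for i j by (simp add: VG_def vf_def)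
  have sh: "snd (hframe L i z) $ j = N i j z" for i j by (simp add: hframe_def)
  \<comment> \<open>The E-terms are symmetric by \<open>dd_E_gl\<close>, the \<open>d\<close>-terms
    because \<open>VGH\<close> is a multiple of p_i, and G_ij p_l by \<open>G_sym\<close>. Only the
    terms with p_j G_il and p_i G_jl survive.\<close>
  have "dd (VG i z) (G j l) z - dd (VG j z) (G i l) z =
      v (H z) / (\<alpha> * \<beta>) * (snd z $ j * G i l z - snd z $ i * G j l z)" for l
    using dd_E_gl[OF z, where i = i and j = j and l = l] G_sym[OF z, of i j] pos
    by (simp add: d VGH sVG dd_VG[OF z df(4)] euler_gl[OF z] field_simps)
  also have "v (H z) / (\<alpha> * \<beta>) * (snd z $ j * G i l z - snd z $ i * G j l z) =
      v (H z) / (\<alpha> * \<beta>\<^sup>2) * (gl i l z * snd z $ j - gl j l z * snd z $ i)" for l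
    using pos by (simp add: G_eq field_simps power2_eq_square)
  finally have vert: "dd (VG i z) (G j l) z - dd (VG j z) (G i l) z =
      v (H z) / (\<alpha> * \<beta>\<^sup>2) * (gl i l z * snd z $ j - gl j l z * snd z $ i)" for l .
  \<comment> \<open>The Euler part of (J \<delta>_i) N_jl is v/(\<alpha>\<beta>) p_i N_jl and
    cancels the same term of \<delta>_j G_il; the terms N_ij p_l cancel by symmetry of
    \<open>N\<close>. The rest is 1/\<beta> times the torsion.\<close>
  have hor: "(dd (VG i z) (N j l) z - dd (hframe L j z) (G i l) z)
      + (dd (hframe L i z) (G j l) z - dd (VG j z) (N i l) z) = 0" for l
  proof -
    have "(dd (VG i z) (N j l) z - dd (hframe L j z) (G i l) z)
      + (dd (hframe L i z) (G j l) z - dd (VG j z) (N i l) z) =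
      1 / \<beta> * ((dd (E i z) (N j l) z - dd (hframe L j z) (gl i l) z)
         - (dd (E j z) (N i l) z - dd (hframe L i z) (gl j l) z))"
      using nonlin_conn_sym[OF z, of i j] pos
      by (simp add: d sh dd_VG[OF z df(8)] euler_N[OF z] dd_hframe_H[OF z] field_simps)
    then show ?thesis using torsion_free[OF z, where i = i and j = j and l = l] by simp
  qed
  have "J z (lie_bracket (\<lambda>w. J w (hframe L i w)) (hframe L j) z)
      + J z (lie_bracket (hframe L i) (\<lambda>w. J w (hframe L j w)) z) =
      J z (lie_bracket (\<lambda>w. J w (hframe L i w)) (hframe L j) z
        + lie_bracket (hframe L i) (\<lambda>w. J w (hframe L j w)) z)"
    by (rule linear_add[OF J_linear[OF z], symmetric])
  also have "lie_bracket (\<lambda>w. J w (hframe L i w)) (hframe L j) z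
        + lie_bracket (hframe L i) (\<lambda>w. J w (hframe L j w)) z = 0"
    unfolding b2 b3 by (simp add: prod_eq_iff vec_eq_iff hor)
  finally have mid: "J z (lie_bracket (\<lambda>w. J w (hframe L i w)) (hframe L j) z)
      + J z (lie_bracket (hframe L i) (\<lambda>w. J w (hframe L j w)) z) = 0"
    by (simp add: linear_0[OF J_linear[OF z]])
  have "nijenhuis J (hframe L i) (hframe L j) z =
      lie_bracket (\<lambda>w. J w (hframe L i w)) (\<lambda>w. J w (hframe L j w)) z
      - (J z (lie_bracket (\<lambda>w. J w (hframe L i w)) (hframe L j) z)
      + J z (lie_bracket (hframe L i) (\<lambda>w. J w (hframe L j w)) z))
      - lie_bracket (hframe L i) (hframe L j) z"
    by (simp add: nijenhuis_def)
  also have "\<dots> = (0, \<chi> l. v (H z) / (\<alpha> * \<beta>\<^sup>2) * (gl i l z * snd z $ j - gl j l z * snd z $ i)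
      - curv L l i j z)"
    unfolding mid b1 b4 vert by (simp add: prod_eq_iff vec_eq_iff)
  finally show ?thesis .
qed

lemma nijenhuis_zero_iff:
  assumes z: "z \<in> S"
  shows "(\<forall>X Y. smooth_on S X \<longrightarrow> smooth_on S Y \<longrightarrow> nijenhuis J X Y z = 0) \<longleftrightarrow>
    (\<forall>i j k. curv L k i j z = - v (H z) / (\<alpha> * \<beta>\<^sup>2) * (gl j k z * snd z $ i - gl i k z * snd z $ j))"
    (is "?lhs \<longleftrightarrow> ?rhs")
proof -
  interpret almost_complex_at J S z by (rule almost_complex_at[OF z])
  have T_h: "T (hframe L i z) (hframe L j z) =
    (0, \<chi> l. v (H z) / (\<alpha> * \<beta>\<^sup>2) * (gl i l z * snd z $ j - gl j l z * snd z $ i) - curv L l i j z)" for i j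
    using nijenhuis_hframe[OF z] nijenhuis_eq_T[OF diff_vector_fields(3)[OF z] diff_vector_fields(3)[OF z]]
    by simp
  have T_iff: "T (hframe L i z) (hframe L j z) = 0 \<longleftrightarrow>
    (\<forall>k. curv L k i j z = - v (H z) / (\<alpha> * \<beta>\<^sup>2) * (gl j k z * snd z $ i - gl i k z * snd z $ j))" for i j
  proof -
    have "V / c * (a - b) - x = 0 \<longleftrightarrow> x = - V / c * (b - a)" for V c a b x :: real
      by (auto simp: algebra_simps diff_divide_distrib)
    then show ?thesis unfolding T_h by (simp add: prod_eq_iff vec_eq_iff)
  qed
  show ?thesis
  proof
    assume ?lhs
    \<comment> \<open>Constant fields are smooth and take every value at \<open>z\<close>, so
      tensoriality turns the hypothesis into vanishing of \<open>T\<close> on all pairs.\<close>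
    then have "nijenhuis J (\<lambda>_. x) (\<lambda>_. y) z = 0" for x y by (simp add: smooth_on_const)
    then have "T x y = 0" for x y by (simp add: nijenhuis_eq_T)
    then show ?rhs using T_iff by blast
  next
    assume ?rhs
    let ?B = "range (\<lambda>i. hframe L i z)"
    let ?V = "span (?B \<union> J z ` ?B)"
    have h: "hframe L i z \<in> ?V" for i by (rule span_base) blast
    have "fv i \<in> ?V" for i
    \<comment> \<open>The inverse of G recovers the vertical frame from the vectors J \<delta>_k, so
      these and the \<delta>_k span.\<close>
    proof -
      have "J z (hframe L k z) \<in> ?V" for k by (rule span_base) blast
      then have "(\<Sum>k\<in>UNIV. Ginv z $ i $ k *\<^sub>R J z (hframe L k z)) \<in> ?V"
        by (intro span_sum span_scale)
      moreover have "(\<Sum>k\<in>UNIV. Ginv z $ i $ k *\<^sub>R J z (hframe L k z)) = fv i"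
        using sum_matrix_scaleR[of "Ginv z" "Glow v \<alpha> \<beta> L z" i fv] G_Ginv[OF z]
        by (simp add: J_h[OF z] vframe_def matrix_left_right_inverse)
      ultimately show ?thesis by simp
    qed
    with h have "u \<in> ?V" for u
      by (subst coords_expand[of u z]) (intro span_add span_sum span_scale)
    then have "?V = UNIV" by blast
    then have "T x y = 0" for x y
      by (rule T_eq_0_if_span) (use T_iff \<open>?rhs\<close> in blast)
    then show ?lhs
      by (metis nijenhuis_eq_T smooth_on_differentiable z)
  qed
qed

end

section \<open>From local representatives to the manifold\<close>

lemma local_rep_lift:
  assumes M: "smooth_manifold M A" and c: "c \<in> A" and z: "z \<in> chart_image c \<times> UNIV"
  obtains q \<omega> where "(q, \<omega>) \<in> cotangent_bundle M A" "q \<in> fst c" "snd c q = fst z" "\<omega> c = snd z"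
    "local_rep M A K c z = K (q, \<omega>)"
proof -
  let ?B = "{u \<in> cotangent_bundle M A. fst u \<in> fst c}"
  let ?u = "inv_into ?B (induced_coords c) z"
  have img: "z \<in> induced_coords c ` ?B"
    using bij_betw_induced_coords[OF M c] z by (auto simp: bij_betw_def)
  obtain q \<omega> where u: "?u = (q, \<omega>)" by (cases ?u)
  have "?u \<in> ?B" "induced_coords c ?u = z"
    using inv_into_into[OF img] f_inv_into_f[OF img] by auto
  moreover have "local_rep M A K c z = K (q, \<omega>)"
    by (simp only: local_rep_def comp_apply u)
  ultimately show ?thesis
    unfolding u by (intro that[of q \<omega>]) (auto simp: induced_coords_def)
qed

lemma local_rep_eq:
  assumes M: "smooth_manifold M A" and c: "c \<in> A"
    and u: "(q, \<omega>) \<in> cotangent_bundle M A" and q: "q \<in> fst c"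
  shows "local_rep M A K c (snd c q, \<omega> c) = K (q, \<omega>)"
proof -
  have "inj_on (induced_coords c) {u \<in> cotangent_bundle M A. fst u \<in> fst c}"
    using bij_betw_induced_coords[OF M c] by (simp add: bij_betw_def)
  from inv_into_f_f[OF this, of "(q, \<omega>)"] u q show ?thesis
    by (simp add: local_rep_def induced_coords_def)
qed

lemma cotangent_bundle_scaleR:
  fixes A :: "('m, 'n::finite) chart set"
  assumes "(q, \<omega>) \<in> cotangent_bundle M A"
  shows "(q, \<lambda>d. r *\<^sub>R \<omega> d) \<in> cotangent_bundle M A"
proof -
  have r: "r *\<^sub>R (x v* B) = (r *\<^sub>R x) v* B" for x :: "real ^ 'n" and B :: "real ^ 'n ^ 'n"
    by (simp add: vector_matrix_mult_def vec_eq_iff sum_distrib_left mult_ac)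
  have q: "q \<in> topspace M" and \<omega>: "\<omega> \<in> cotangent_space A q"
    using assms by (simp_all add: cotangent_bundle_def)
  have "(\<lambda>d. r *\<^sub>R \<omega> d) \<in> cotangent_space A q"
    unfolding cotangent_space_def
  proof (intro CollectI conjI allI ballI impI)
    fix c assume "\<not> (c \<in> A \<and> q \<in> fst c)"
    then have "\<omega> c = 0" using \<omega> unfolding cotangent_space_def by blast
    then show "r *\<^sub>R \<omega> c = 0" by simp
  next
    fix c d assume "c \<in> A" "d \<in> A" "q \<in> fst c \<and> q \<in> fst d"
    then have "\<omega> c = \<omega> d v* jacobian (transition c d) (at (snd c q))"
      using \<omega> unfolding cotangent_space_def by blast
    then show "r *\<^sub>R \<omega> c = (r *\<^sub>R \<omega> d) v* jacobian (transition c d) (at (snd c q))"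
      by (simp only: r)
  qed
  with q show ?thesis by (simp add: cotangent_bundle_def)
qed

text \<open>Homogeneity is stated on the bundle; (x, p) is lifted to a covector, which is scaled in
  all charts at once and read off again in the chart \<open>c\<close>.\<close>

lemma cartan_chart_local_rep:
  fixes A :: "('m, 'n::finite) chart set"
  assumes K: "cartan_space M A K" and c: "c \<in> A"
  shows "cartan_chart (chart_image c) (local_rep M A K c)"
proof
  have M: "smooth_manifold M A" using K by (simp add: cartan_space_def)
  show "open (chart_image c)" using M c by (auto simp: smooth_manifold_def is_chart_def)
  show "smooth_on (chart_image c \<times> - {0}) (local_rep M A K c)"
    using K c by (auto simp: cartan_space_def slit_domain_def)
  show "0 < \<xi> \<bullet> (gup (local_rep M A K c) z *v \<xi>)" if "z \<in> chart_image c \<times> - {0}" "\<xi> \<noteq> 0" for z \<xi>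
    using K c that unfolding cartan_space_def slit_domain_def by blast
  fix x p :: "real ^ 'n" and r :: real
  assume x: "x \<in> chart_image c" and r: "r > 0"
  have z: "(x, p) \<in> chart_image c \<times> UNIV" using x by simp
  obtain q \<omega> where u: "(q, \<omega>) \<in> cotangent_bundle M A" "q \<in> fst c" "snd c q = x" "\<omega> c = p"
    "local_rep M A K c (x, p) = K (q, \<omega>)"
    by (rule local_rep_lift[OF M c z, of K]) auto
  have "local_rep M A K c (x, r *\<^sub>R p) = K (q, \<lambda>d. r *\<^sub>R \<omega> d)"
    using local_rep_eq[OF M c cotangent_bundle_scaleR[OF u(1)] u(2), of K r] u(3,4) by simp
  also have "\<dots> = r * K (q, \<omega>)"
    using K u(1) r unfolding cartan_space_def by blast
  finally show "local_rep M A K c (x, r *\<^sub>R p) = r * local_rep M A K c (x, p)" by (simp add: u(5))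
qed

section \<open>The function v on the half-line\<close>

lemma smooth_on_halfline_differentiable:
  assumes "smooth_on_halfline f" "t > 0"
  shows "f differentiable (at t)"
proof -
  obtain d where d: "\<And>t. t \<ge> 0 \<Longrightarrow> d 0 t = f t"
    "\<And>k t. t \<ge> 0 \<Longrightarrow> (d k has_real_derivative d (Suc k) t) (at t within {0..})"
    using assms(1) unfolding smooth_on_halfline_def by blast
  have "(d 0 has_real_derivative d (Suc 0) t) (at t)"
    using d(2)[of t 0] assms(2) at_within_interior[of t "{0..}"] by simp
  then have "(f has_real_derivative d (Suc 0) t) (at t)"
    by (rule has_field_derivative_transform_within_open[where S = "{0<..}"]) (use assms(2) d in auto)
  then show ?thesis by (auto simp: real_differentiable_def)
qed

text \<open>Nonzero momenta have \<tau> > 0, so the curvature condition never sees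
  \<open>v 0\<close>; the limit from the right recovers it.\<close>

lemma smooth_on_halfline_continuous_0:
  assumes "smooth_on_halfline f"
  shows "(f \<longlongrightarrow> f 0) (at_right 0)"
proof -
  obtain d where d: "\<And>t. t \<ge> 0 \<Longrightarrow> d 0 t = f t"
    "\<And>k t. t \<ge> 0 \<Longrightarrow> (d k has_real_derivative d (Suc k) t) (at t within {0..})"
    using assms(1) unfolding smooth_on_halfline_def by blast
  have "(d 0 \<longlongrightarrow> d 0 0) (at 0 within {0..})"
    using DERIV_continuous[OF d(2)[of 0 0]] by (simp add: continuous_within)
  then have "(d 0 \<longlongrightarrow> f 0) (at_right 0)"
    using d(1)[of 0] by (auto intro: tendsto_within_subset)
  moreover have "\<forall>\<^sub>F t in at_right 0. d 0 t = f t"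
    using d(1) by (auto simp: eventually_at intro!: exI[of _ 1])
  ultimately show ?thesis by (metis tendsto_cong)
qed

text \<open>The curvature is homogeneous of degree one in the momenta, so along a single ray the factor
  \<open>v \<circ> \<tau>\<close> cannot change; a single chart point therefore already determines \<open>v\<close>.\<close>

lemma (in cartan_acs) v_const_if_curv:
  assumes dim: "CARD('n) \<ge> 2" and z0: "z0 \<in> S"
    and v0: "(v \<longlongrightarrow> v 0) (at_right 0)"
    and R: "\<And>z i j k. z \<in> S \<Longrightarrow> curv L k i j z =
        - v (H z) / (\<alpha> * \<beta>\<^sup>2) * (gl j k z * snd z $ i - gl i k z * snd z $ j)"
    and t: "t \<ge> 0"
  shows "v t = v (H z0)"
proof -
  have "snd z0 \<noteq> 0" using z0 by (auto simp: S_def)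
  then obtain i where i: "snd z0 $ i \<noteq> 0" by (auto simp: vec_eq_iff)
  obtain j where j: "j \<noteq> i"
  proof -
    have "CARD('n) \<noteq> card {i}" using dim by simp
    then have "UNIV \<noteq> {i}" by metis
    then show ?thesis using that by blast
  qed
  have "\<exists>k. gl j k z0 * snd z0 $ i - gl i k z0 * snd z0 $ j \<noteq> 0"
  proof (rule ccontr)
    assume "\<not> ?thesis"
    then have 0: "gl j k z0 * snd z0 $ i - gl i k z0 * snd z0 $ j = 0" for k by blast
    \<comment> \<open>Contraction over k with g^{kj} for the fixed j \<noteq> i: the first product
      is a diagonal entry of the unit matrix, the second an off-diagonal one, so p_i is
      left.\<close>
    have "0 = (\<Sum>k\<in>UNIV. (gl j k z0 * snd z0 $ i - gl i k z0 * snd z0 $ j) * gu k j z0)"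
      by (simp only: 0) simp
    also have "\<dots> = (\<Sum>k\<in>UNIV. gl j k z0 * gu k j z0) * snd z0 $ i - (\<Sum>k\<in>UNIV. gl i k z0 * gu k j z0) * snd z0 $ j"
      unfolding sum_distrib_right sum_subtractf[symmetric]
      by (intro sum.cong refl) (simp add: algebra_simps)
    also have "\<dots> = snd z0 $ i" using j by (simp add: gl_gu[OF z0])
    finally show False using i by simp
  qed
  then obtain k where k: "gl j k z0 * snd z0 $ i - gl i k z0 * snd z0 $ j \<noteq> 0" by blast
  have ray: "v (r\<^sup>2 * H z0) = v (H z0)" if r: "r > 0" for r
  proof -
    let ?W = "gl j k z0 * snd z0 $ i - gl i k z0 * snd z0 $ j"
    have "curv L k i j (dil r z0) = r * curv L k i j z0"
      using scales_curv[OF r] z0 by (simp add: scales_def)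
    then have "- v (H (dil r z0)) / (\<alpha> * \<beta>\<^sup>2) * (gl j k (dil r z0) * snd (dil r z0) $ i
        - gl i k (dil r z0) * snd (dil r z0) $ j) = r * (- v (H z0) / (\<alpha> * \<beta>\<^sup>2) * ?W)"
      by (simp only: R[OF z0] R[OF dil_in_S[OF r z0]])
    then have "- v (r\<^sup>2 * H z0) / (\<alpha> * \<beta>\<^sup>2) * (r * ?W) = - v (H z0) / (\<alpha> * \<beta>\<^sup>2) * (r * ?W)"
      using scales_gl[OF r] scales_H[OF r] z0
      by (simp add: scales_def dil_def right_diff_distrib mult_ac)
    moreover have "r * ?W \<noteq> 0" using r k by simp
    ultimately have "- v (r\<^sup>2 * H z0) / (\<alpha> * \<beta>\<^sup>2) = - v (H z0) / (\<alpha> * \<beta>\<^sup>2)"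
      by (metis mult_right_cancel)
    then show ?thesis using pos by simp
  qed
  have v_pos: "v s = v (H z0)" if s: "s > 0" for s
  proof -
    \<comment> \<open>The energy at the momentum r p is r^2 times that at p; this r reaches the
      prescribed value \<open>s\<close>.\<close>
    have "(sqrt (s / H z0))\<^sup>2 * H z0 = s" using s H_pos[OF z0] by simp
    then show ?thesis using ray[of "sqrt (s / H z0)"] s H_pos[OF z0] by simp
  qed
  show ?thesis
  proof (cases "t = 0")
    case True
    have "\<forall>\<^sub>F s in at_right 0. v s = v (H z0)"
      using eventually_at_right_less[of "0::real"] by eventually_elim (rule v_pos)
    then have "(v \<longlongrightarrow> v (H z0)) (at_right 0)" by (rule tendsto_eventually)
    then have "v 0 = v (H z0)" by (rule tendsto_unique[OF trivial_limit_at_right_real v0])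
    with True show ?thesis by simp
  qed (use v_pos t in auto)
qed

theorem theorem3p4:
  fixes M :: "'m topology"
    and A :: "('m, 'n::finite) chart set"
    and K :: "'m \<times> ('m, 'n) covector \<Rightarrow> real"
    and v :: "real \<Rightarrow> real"
    and \<alpha> \<beta> :: real
    and J :: "('m, 'n) chart \<Rightarrow> 'n coords \<Rightarrow> 'n coords \<Rightarrow> 'n coords"
  assumes cartan: "cartan_space M A K"
    and dim: "CARD('n) \<ge> 3"
    and smooth: "smooth_on_halfline v"
    and pos: "\<alpha> > 0" "\<beta> > 0"
    and pos': "\<And>u. u \<in> slit_cotangent_bundle M A \<Longrightarrow> \<alpha> + 2 * tau (K u) * v (tau (K u)) > 0"
    and J_linear: "\<And>c z. c \<in> A \<Longrightarrow> z \<in> slit_domain c \<Longrightarrow> linear (J c z)"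
    and J_h: "\<And>c z i. c \<in> A \<Longrightarrow> z \<in> slit_domain c \<Longrightarrow>
      J c z (hframe (local_rep M A K c) i z) = (\<Sum>k\<in>UNIV. Glow v \<alpha> \<beta> (local_rep M A K c) z $ i $ k *\<^sub>R vframe k)"
    and J_v: "\<And>c z i. c \<in> A \<Longrightarrow> z \<in> slit_domain c \<Longrightarrow>
      J c z (vframe i) = - (\<Sum>k\<in>UNIV. Gup v \<alpha> \<beta> (local_rep M A K c) z $ i $ k *\<^sub>R hframe (local_rep M A K c) k z)"
  shows "integrable_acs A J \<longleftrightarrow>
    (\<exists>C::real.
       (\<forall>c\<in>A. \<forall>z\<in>slit_domain c. \<forall>i j k.
          curv (local_rep M A K c) k i j z =
            C * (glow (local_rep M A K c) z $ j $ k * snd z $ i - glow (local_rep M A K c) z $ i $ k * snd z $ j)) \<and>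
       (\<forall>t\<ge>0. v t = - C * \<alpha> * \<beta>\<^sup>2))"
proof -
  have M: "smooth_manifold M A" using cartan by (simp add: cartan_space_def)
  let ?L = "local_rep M A K"
  let ?U = "\<lambda>c. chart_image c :: (real ^ 'n) set"
  have S: "cartan_chart.S (?U c) = slit_domain c" if "c \<in> A" for c
    using cartan_chart.S_def[OF cartan_chart_local_rep[OF cartan that]] by (simp add: slit_domain_def)
  have H: "cartan_chart.H (?L c) z = tau (?L c z)" if "c \<in> A" for c z
    using cartan_chart.H_def[OF cartan_chart_local_rep[OF cartan that]] by simp
  have pos_c: "0 < \<alpha> + 2 * tau (?L c z) * v (tau (?L c z))" if c: "c \<in> A" and z: "z \<in> slit_domain c" for c z
  proof -
    have z': "z \<in> chart_image c \<times> UNIV" using z by (auto simp: slit_domain_def)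
    obtain q \<omega> where u: "(q, \<omega>) \<in> cotangent_bundle M A" "\<omega> c = snd z" "?L c z = K (q, \<omega>)"
      by (rule local_rep_lift[OF M c z', of K]) auto
    have "\<omega> \<noteq> (\<lambda>_. 0)" using u(2) z by (auto simp: slit_domain_def)
    then show ?thesis using pos'[of "(q, \<omega>)"] u by (auto simp: slit_cotangent_bundle_def)
  qed
  have acs: "cartan_acs (?U c) (?L c) v \<alpha> \<beta> (J c)" if c: "c \<in> A" for c
  proof -
    interpret cartan_chart "?U c" "?L c" by (rule cartan_chart_local_rep[OF cartan c])
    show ?thesis
      by (intro cartan_acs.intro cartan_acs_axioms.intro cartan_chart_axioms)
         (use pos smooth_on_halfline_differentiable[OF smooth] pos_c[OF c] J_linear[OF c] J_h[OF c] J_v[OF c]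
           in \<open>simp_all add: S[OF c] H[OF c]\<close>)
  qed
  have integrable_iff: "integrable_acs A J \<longleftrightarrow> (\<forall>c\<in>A. \<forall>z\<in>slit_domain c. \<forall>i j k. curv (?L c) k i j z =
      - v (tau (?L c z)) / (\<alpha> * \<beta>\<^sup>2) * (glow (?L c) z $ j $ k * snd z $ i - glow (?L c) z $ i $ k * snd z $ j))"
    (is "_ \<longleftrightarrow> (\<forall>c\<in>A. \<forall>z\<in>slit_domain c. ?R c z)")
  proof -
    have "(\<forall>X Y. smooth_on (slit_domain c) X \<longrightarrow> smooth_on (slit_domain c) Y \<longrightarrow> nijenhuis (J c) X Y z = 0)
        \<longleftrightarrow> ?R c z" if "c \<in> A" "z \<in> slit_domain c" for c z
      using cartan_acs.nijenhuis_zero_iff[OF acs[OF that(1)], of z] that by (simp only: S H)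
    then show ?thesis unfolding integrable_acs_def by blast
  qed
  have "topspace M \<noteq> {} \<and> (\<Union>c\<in>A. fst c) = topspace M"
    using M unfolding smooth_manifold_def by (elim conjE) (rule conjI)
  then obtain q c0 where c0: "c0 \<in> A" "q \<in> fst c0" by blast
  define z0 :: "'n coords" where "z0 = (snd c0 q, axis undefined 1)"
  have z0: "z0 \<in> slit_domain c0"
    using c0 by (simp add: z0_def slit_domain_def chart_image_def axis_eq_0_iff)
  interpret c0: cartan_acs "?U c0" "?L c0" v \<alpha> \<beta> "J c0" by (rule acs[OF c0(1)])
  show ?thesis
  proof
    assume int: "integrable_acs A J"
    \<comment> \<open>Solves v = - C \<alpha> \<beta>^2 for the value of \<open>v\<close> at
      \<open>z0\<close>. As \<open>v\<close> is one function on the half-line, the constant is the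
      same in all charts.\<close>
    define C where "C = - v (tau (?L c0 z0)) / (\<alpha> * \<beta>\<^sup>2)"
    have v: "v t = v (tau (?L c0 z0))" if "t \<ge> 0" for t
    proof -
      have "v t = v (c0.H z0)"
      proof (rule c0.v_const_if_curv[OF _ _ smooth_on_halfline_continuous_0[OF smooth] _ that])
        show "2 \<le> CARD('n)" using dim by simp
        show "z0 \<in> c0.S" using z0 by (simp only: S[OF c0(1)])
        fix z i j k assume "z \<in> c0.S"
        then show "curv (?L c0) k i j z = - v (c0.H z) / (\<alpha> * \<beta>\<^sup>2) *
            (glow (?L c0) z $ j $ k * snd z $ i - glow (?L c0) z $ i $ k * snd z $ j)"
          using int c0(1) unfolding integrable_iff S[OF c0(1)] H[OF c0(1)] by blast
      qed
      then show ?thesis by (simp only: H[OF c0(1)])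
    qed
    \<comment> \<open>\<open>tau\<close> is half a square, so its values lie in the half-line on
      which \<open>v\<close> is known to be constant.\<close>
    have "- v (tau (?L c z)) / (\<alpha> * \<beta>\<^sup>2) = C" for c z
      using v[of "tau (?L c z)"] by (simp add: C_def tau_def)
    moreover have "v t = - C * \<alpha> * \<beta>\<^sup>2" if "t \<ge> 0" for t
      using v[OF that] pos by (simp add: C_def)
    ultimately show "\<exists>C. (\<forall>c\<in>A. \<forall>z\<in>slit_domain c. \<forall>i j k. curv (?L c) k i j z =
        C * (glow (?L c) z $ j $ k * snd z $ i - glow (?L c) z $ i $ k * snd z $ j)) \<and>
       (\<forall>t\<ge>0. v t = - C * \<alpha> * \<beta>\<^sup>2)"
      using int unfolding integrable_iff by (intro exI[of _ C]) simp
  next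
    assume "\<exists>C. (\<forall>c\<in>A. \<forall>z\<in>slit_domain c. \<forall>i j k. curv (?L c) k i j z =
        C * (glow (?L c) z $ j $ k * snd z $ i - glow (?L c) z $ i $ k * snd z $ j)) \<and>
       (\<forall>t\<ge>0. v t = - C * \<alpha> * \<beta>\<^sup>2)"
    then obtain C where R: "\<forall>c\<in>A. \<forall>z\<in>slit_domain c. \<forall>i j k. curv (?L c) k i j z =
        C * (glow (?L c) z $ j $ k * snd z $ i - glow (?L c) z $ i $ k * snd z $ j)"
      and v: "\<And>t. t \<ge> 0 \<Longrightarrow> v t = - C * \<alpha> * \<beta>\<^sup>2"
      by blast
    have "- v (tau (?L c z)) / (\<alpha> * \<beta>\<^sup>2) = C" for c z
      using v[of "tau (?L c z)"] pos by (simp add: tau_def)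
    then show "integrable_acs A J" unfolding integrable_iff using R by simp
  qed
qed

end
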